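(* Let $\mathcal{E}$ be a cocomplete closed symmetric monoidal category and let $(R,\mu,\eta)$ be a solid monoid in $\mathcal{E}$. Denote by $L_R\text{-loc}$ the full subcategory of $L_R$-local objects of $\mathcal{E}$, by $C_R\text{-coloc}$ the full subcategory of $C_R$-colocal objects of $\mathcal{E}$, and by $R\text{-mod}$ the category of $R$-modules. Then there are equivalences of categories $$L_R\text{-loc}\;\cong\; R\text{-mod}\;\cong\; C_R\text{-coloc}.$$
   Context: Let $\otimes$, $I$, $\operatorname{Hom}_{\mathcal{E}}(-,-)$ be the tensor product, unit and internal hom of $\mathcal{E}$. A monoid $(R,\mu,\eta)$ in $\mathcal{E}$ is solid if $\mu\colon R\otimes R\to R$ is an isomorphism. An $R$-module is an object $X$ with a morphism $R\otimes X\to X$ that is associative and unital; morphisms of $R$-modules are the morphisms in $\mathcal{E}$ compatible with the module structures. A localization functor in $\mathcal{E}$ is a functor $L$ with a natural transformation $l\colon \mathrm{Id}\to L$ such that $l_{LX}=Ll_X$ is an isomorphism for every $X$; the $L$-local objects are the objects isomorphic to one in the image of $L$, and a morphism $f$ is an $L$-local equivalence if $L(f)$ is an isomorphism. Dually, a colocalization functor is a functor $C$ with a natural transformation $c\colon C\to\mathrm{Id}$ such that $c_{CX}=Cc_X$ is an isomorphism for every $X$; the $C$-colocal objects are the objects isomorphic to one in the image of $C$, and $f$ is a $C$-colocal equivalence if $C(f)$ is an isomorphism. A morphism $f$ is an $R$-equivalence if $R\otimes f$ is an isomorphism. An object $Z$ is $R$-local if $f^*\colon\operatorname{Hom}_{\mathcal{E}}(Y,Z)\to\operatorname{Hom}_{\mathcal{E}}(X,Z)$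 is an isomorphism for every $R$-equivalence $f\colon X\to Y$. $L_R$ denotes the localization functor whose local objects are the $R$-local objects and whose local equivalences are the $R$-equivalences. A morphism $g\colon U\to W$ is an $R$-colocal equivalence if $g_*\colon\operatorname{Hom}_{\mathcal{E}}(R,U)\to\operatorname{Hom}_{\mathcal{E}}(R,W)$ is an isomorphism. An object $Z$ is $R$-colocal if $g_*\colon\operatorname{Hom}_{\mathcal{E}}(Z,U)\to\operatorname{Hom}_{\mathcal{E}}(Z,W)$ is an isomorphism for every $R$-colocal equivalence $g\colon U\to W$. $C_R$ denotes the colocalization functor whose colocal objects are the $R$-colocal objects and whose colocal equivalences are the $R$-colocal equivalences. It is a standing assumption that $L_R$ and $C_R$ exist. *)

theory Defs
  imports "HOL-Library.Equipollence"
begin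

section \<open>Categories, functors, natural transformations\<close>

record ('o, 'a) cat =
  Obj :: "'o set"
  Arr :: "'a set"
  Dom :: "'a \<Rightarrow> 'o"
  Cod :: "'a \<Rightarrow> 'o"
  Ident :: "'o \<Rightarrow> 'a"
  Comp :: "'a \<Rightarrow> 'a \<Rightarrow> 'a"  (infixr \<open>\<cdot>\<index>\<close> 70)

text \<open>Composition is in applicative order: \<open>g \<cdot> f\<close> is \<open>g\<close> after \<open>f\<close>.\<close>

definition hom :: "('o, 'a, 'm) cat_scheme \<Rightarrow> 'o \<Rightarrow> 'o \<Rightarrow> 'a set" where
  "hom C X Y = {f \<in> Arr C. Dom C f = X \<and> Cod C f = Y}"

locale category =
  fixes C :: "('o, 'a, 'm) cat_scheme" (structure)
  assumes dom_in_Obj: "f \<in> Arr C \<Longrightarrow> Dom C f \<in> Obj C"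
    and cod_in_Obj: "f \<in> Arr C \<Longrightarrow> Cod C f \<in> Obj C"
    and ident_hom: "X \<in> Obj C \<Longrightarrow> Ident C X \<in> hom C X X"
    and comp_hom: "f \<in> hom C X Y \<Longrightarrow> g \<in> hom C Y Z \<Longrightarrow> g \<cdot> f \<in> hom C X Z"
    and comp_ident: "f \<in> hom C X Y \<Longrightarrow> f \<cdot> Ident C X = f"
    and ident_comp: "f \<in> hom C X Y \<Longrightarrow> Ident C Y \<cdot> f = f"
    and comp_assoc: "f \<in> hom C W X \<Longrightarrow> g \<in> hom C X Y \<Longrightarrow> h \<in> hom C Y Z \<Longrightarrow>
      (h \<cdot> g) \<cdot> f = h \<cdot> (g \<cdot> f)"

definition iso :: "('o, 'a, 'm) cat_scheme \<Rightarrow> 'a \<Rightarrow> bool" where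
  "iso C f \<longleftrightarrow> f \<in> Arr C \<and>
    (\<exists>g \<in> hom C (Cod C f) (Dom C f).
      g \<cdot>\<^bsub>C\<^esub> f = Ident C (Dom C f) \<and> f \<cdot>\<^bsub>C\<^esub> g = Ident C (Cod C f))"

definition isomorphic :: "('o, 'a, 'm) cat_scheme \<Rightarrow> 'o \<Rightarrow> 'o \<Rightarrow> bool" where
  "isomorphic C X Y \<longleftrightarrow> (\<exists>f \<in> hom C X Y. iso C f)"

definition full_subcategory :: "('o, 'a, 'm) cat_scheme \<Rightarrow> 'o set \<Rightarrow> ('o, 'a) cat" where
  "full_subcategory C P =
    \<lparr>Obj = Obj C \<inter> P,
     Arr = {f \<in> Arr C. Dom C f \<in> P \<and> Cod C f \<in> P},
     Dom = Dom C, Cod = Cod C, Ident = Ident C, Comp = Comp C\<rparr>"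

record ('o, 'a, 'p, 'b) fun_data =
  Fobj :: "'o \<Rightarrow> 'p"
  Farr :: "'a \<Rightarrow> 'b"

definition is_functor ::
  "('o, 'a, 'm) cat_scheme \<Rightarrow> ('p, 'b, 'n) cat_scheme \<Rightarrow> ('o, 'a, 'p, 'b) fun_data \<Rightarrow> bool" where
  "is_functor C D F \<longleftrightarrow>
    (\<forall>X \<in> Obj C. Fobj F X \<in> Obj D \<and> Farr F (Ident C X) = Ident D (Fobj F X)) \<and>
    (\<forall>X Y. \<forall>f \<in> hom C X Y. Farr F f \<in> hom D (Fobj F X) (Fobj F Y)) \<and>
    (\<forall>X Y Z. \<forall>f \<in> hom C X Y. \<forall>g \<in> hom C Y Z. Farr F (g \<cdot>\<^bsub>C\<^esub> f) = Farr F g \<cdot>\<^bsub>D\<^esub> Farr F f)"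

definition id_fun :: "('o, 'a, 'o, 'a) fun_data" where
  "id_fun = \<lparr>Fobj = (\<lambda>X. X), Farr = (\<lambda>f. f)\<rparr>"

definition comp_fun ::
  "('p, 'b, 'q, 'c) fun_data \<Rightarrow> ('o, 'a, 'p, 'b) fun_data \<Rightarrow> ('o, 'a, 'q, 'c) fun_data" where
  "comp_fun G F = \<lparr>Fobj = Fobj G \<circ> Fobj F, Farr = Farr G \<circ> Farr F\<rparr>"

definition nat_trans ::
  "('o, 'a, 'm) cat_scheme \<Rightarrow> ('p, 'b, 'n) cat_scheme \<Rightarrow>
    ('o, 'a, 'p, 'b) fun_data \<Rightarrow> ('o, 'a, 'p, 'b) fun_data \<Rightarrow> ('o \<Rightarrow> 'b) \<Rightarrow> bool" where
  "nat_trans C D F G t \<longleftrightarrow>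
    (\<forall>X \<in> Obj C. t X \<in> hom D (Fobj F X) (Fobj G X)) \<and>
    (\<forall>X Y. \<forall>f \<in> hom C X Y. t Y \<cdot>\<^bsub>D\<^esub> Farr F f = Farr G f \<cdot>\<^bsub>D\<^esub> t X)"

definition nat_iso ::
  "('o, 'a, 'm) cat_scheme \<Rightarrow> ('p, 'b, 'n) cat_scheme \<Rightarrow>
    ('o, 'a, 'p, 'b) fun_data \<Rightarrow> ('o, 'a, 'p, 'b) fun_data \<Rightarrow> ('o \<Rightarrow> 'b) \<Rightarrow> bool" where
  "nat_iso C D F G t \<longleftrightarrow> nat_trans C D F G t \<and> (\<forall>X \<in> Obj C. iso D (t X))"

definition equivalent_categories ::
  "('o, 'a, 'm) cat_scheme \<Rightarrow> ('p, 'b, 'n) cat_scheme \<Rightarrow> bool" where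
  "equivalent_categories C D \<longleftrightarrow> category C \<and> category D \<and>
    (\<exists>F G. is_functor C D F \<and> is_functor D C G \<and>
      (\<exists>t. nat_iso C C id_fun (comp_fun G F) t) \<and>
      (\<exists>t. nat_iso D D (comp_fun F G) id_fun t))"

section \<open>Cocompleteness\<close>

definition cocone ::
  "('i, 'u) cat \<Rightarrow> ('o, 'a, 'm) cat_scheme \<Rightarrow> ('i, 'u, 'o, 'a) fun_data \<Rightarrow> 'o \<Rightarrow> ('i \<Rightarrow> 'a) \<Rightarrow> bool"
  where
  "cocone J C D K k \<longleftrightarrow> K \<in> Obj C \<and>
    (\<forall>i \<in> Obj J. k i \<in> hom C (Fobj D i) K) \<and>
    (\<forall>i j. \<forall>u \<in> hom J i j. k j \<cdot>\<^bsub>C\<^esub> Farr D u = k i)"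

definition colimit ::
  "('i, 'u) cat \<Rightarrow> ('o, 'a, 'm) cat_scheme \<Rightarrow> ('i, 'u, 'o, 'a) fun_data \<Rightarrow> 'o \<Rightarrow> ('i \<Rightarrow> 'a) \<Rightarrow> bool"
  where
  "colimit J C D K k \<longleftrightarrow> cocone J C D K k \<and>
    (\<forall>K' k'. cocone J C D K' k' \<longrightarrow>
      (\<exists>!h. h \<in> hom C K K' \<and> (\<forall>i \<in> Obj J. h \<cdot>\<^bsub>C\<^esub> k i = k' i)))"

text \<open>
  Smallness is relative to a type \<open>'s\<close> playing the role of the universe: a set is small if
  its cardinality is strictly less than that of \<open>'s\<close>. If \<open>'s\<close> has the cardinality of a
  Grothendieck universe, these are exactly the sets equinumerous with a member of that universe.
  Every small category is isomorphic to one whose objects and arrows are elements of \<open>'s\<close>,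
  so it suffices to let the shapes range over the latter.
\<close>

definition cocomplete :: "'s itself \<Rightarrow> ('o, 'a, 'm) cat_scheme \<Rightarrow> bool" where
  "cocomplete _ C \<longleftrightarrow>
    (\<forall>(J :: ('s, 's) cat) D.
      category J \<and> Obj J \<prec> (UNIV :: 's set) \<and> Arr J \<prec> (UNIV :: 's set) \<and> is_functor J C D \<longrightarrow>
      (\<exists>K k. colimit J C D K k))"

section \<open>Closed symmetric monoidal categories\<close>

text \<open>
  Orientations:
  \<open>Assoc X Y Z : (X \<otimes> Y) \<otimes> Z \<rightarrow> X \<otimes> (Y \<otimes> Z)\<close>,
  \<open>Lunit X : I \<otimes> X \<rightarrow> X\<close>,
  \<open>Runit X : X \<otimes> I \<rightarrow> X\<close>,
  \<open>Braid X Y : X \<otimes> Y \<rightarrow> Y \<otimes> X\<close>,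
  \<open>Eval X Y : Ihom X Y \<otimes> X \<rightarrow> Y\<close>.
\<close>

record ('o, 'a) csm_cat = "('o, 'a) cat" +
  Tobj :: "'o \<Rightarrow> 'o \<Rightarrow> 'o"  (infixr \<open>\<otimes>\<index>\<close> 75)
  Tarr :: "'a \<Rightarrow> 'a \<Rightarrow> 'a"  (infixr \<open>\<otimes>\<^sub>a\<index>\<close> 75)
  Unit :: "'o"
  Assoc :: "'o \<Rightarrow> 'o \<Rightarrow> 'o \<Rightarrow> 'a"
  Lunit :: "'o \<Rightarrow> 'a"
  Runit :: "'o \<Rightarrow> 'a"
  Braid :: "'o \<Rightarrow> 'o \<Rightarrow> 'a"
  Ihom :: "'o \<Rightarrow> 'o \<Rightarrow> 'o"
  Eval :: "'o \<Rightarrow> 'o \<Rightarrow> 'a"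

locale monoidal_category = category E
  for E :: "('o, 'a, 'm) csm_cat_scheme" (structure) +
  assumes tensor_obj: "X \<in> Obj E \<Longrightarrow> Y \<in> Obj E \<Longrightarrow> X \<otimes> Y \<in> Obj E"
    and tensor_hom: "f \<in> hom E X X' \<Longrightarrow> g \<in> hom E Y Y' \<Longrightarrow>
      f \<otimes>\<^sub>a g \<in> hom E (X \<otimes> Y) (X' \<otimes> Y')"
    and tensor_ident: "X \<in> Obj E \<Longrightarrow> Y \<in> Obj E \<Longrightarrow>
      Ident E X \<otimes>\<^sub>a Ident E Y = Ident E (X \<otimes> Y)"
    and tensor_comp: "f \<in> hom E X X' \<Longrightarrow> f' \<in> hom E X' X'' \<Longrightarrow>
      g \<in> hom E Y Y' \<Longrightarrow> g' \<in> hom E Y' Y'' \<Longrightarrow>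
      (f' \<cdot> f) \<otimes>\<^sub>a (g' \<cdot> g) = (f' \<otimes>\<^sub>a g') \<cdot> (f \<otimes>\<^sub>a g)"
    and unit_obj: "Unit E \<in> Obj E"
    and assoc_hom: "X \<in> Obj E \<Longrightarrow> Y \<in> Obj E \<Longrightarrow> Z \<in> Obj E \<Longrightarrow>
      Assoc E X Y Z \<in> hom E ((X \<otimes> Y) \<otimes> Z) (X \<otimes> (Y \<otimes> Z))"
    and assoc_iso: "X \<in> Obj E \<Longrightarrow> Y \<in> Obj E \<Longrightarrow> Z \<in> Obj E \<Longrightarrow> iso E (Assoc E X Y Z)"
    and assoc_natural: "f \<in> hom E X X' \<Longrightarrow> g \<in> hom E Y Y' \<Longrightarrow> h \<in> hom E Z Z' \<Longrightarrow>
      Assoc E X' Y' Z' \<cdot> ((f \<otimes>\<^sub>a g) \<otimes>\<^sub>a h) = (f \<otimes>\<^sub>a (g \<otimes>\<^sub>a h)) \<cdot> Assoc E X Y Z"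
    and lunit_hom: "X \<in> Obj E \<Longrightarrow> Lunit E X \<in> hom E (Unit E \<otimes> X) X"
    and lunit_iso: "X \<in> Obj E \<Longrightarrow> iso E (Lunit E X)"
    and lunit_natural: "f \<in> hom E X Y \<Longrightarrow>
      Lunit E Y \<cdot> (Ident E (Unit E) \<otimes>\<^sub>a f) = f \<cdot> Lunit E X"
    and runit_hom: "X \<in> Obj E \<Longrightarrow> Runit E X \<in> hom E (X \<otimes> Unit E) X"
    and runit_iso: "X \<in> Obj E \<Longrightarrow> iso E (Runit E X)"
    and runit_natural: "f \<in> hom E X Y \<Longrightarrow>
      Runit E Y \<cdot> (f \<otimes>\<^sub>a Ident E (Unit E)) = f \<cdot> Runit E X"
    and pentagon: "W \<in> Obj E \<Longrightarrow> X \<in> Obj E \<Longrightarrow> Y \<in> Obj E \<Longrightarrow> Z \<in> Obj E \<Longrightarrow>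
      Assoc E W X (Y \<otimes> Z) \<cdot> Assoc E (W \<otimes> X) Y Z =
      (Ident E W \<otimes>\<^sub>a Assoc E X Y Z) \<cdot> Assoc E W (X \<otimes> Y) Z \<cdot> (Assoc E W X Y \<otimes>\<^sub>a Ident E Z)"
    and triangle: "X \<in> Obj E \<Longrightarrow> Y \<in> Obj E \<Longrightarrow>
      (Ident E X \<otimes>\<^sub>a Lunit E Y) \<cdot> Assoc E X (Unit E) Y = Runit E X \<otimes>\<^sub>a Ident E Y"

locale symmetric_monoidal_category = monoidal_category +
  assumes braid_hom: "X \<in> Obj E \<Longrightarrow> Y \<in> Obj E \<Longrightarrow> Braid E X Y \<in> hom E (X \<otimes> Y) (Y \<otimes> X)"
    and braid_natural: "f \<in> hom E X X' \<Longrightarrow> g \<in> hom E Y Y' \<Longrightarrow>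
      Braid E X' Y' \<cdot> (f \<otimes>\<^sub>a g) = (g \<otimes>\<^sub>a f) \<cdot> Braid E X Y"
    and braid_symmetric: "X \<in> Obj E \<Longrightarrow> Y \<in> Obj E \<Longrightarrow>
      Braid E Y X \<cdot> Braid E X Y = Ident E (X \<otimes> Y)"
    and hexagon: "X \<in> Obj E \<Longrightarrow> Y \<in> Obj E \<Longrightarrow> Z \<in> Obj E \<Longrightarrow>
      Assoc E Y Z X \<cdot> Braid E X (Y \<otimes> Z) \<cdot> Assoc E X Y Z =
      (Ident E Y \<otimes>\<^sub>a Braid E X Z) \<cdot> Assoc E Y X Z \<cdot> (Braid E X Y \<otimes>\<^sub>a Ident E Z)"

text \<open>
  Closedness: \<open>Eval X Y\<close> is universal among arrows \<open>W \<otimes> X \<rightarrow> Y\<close>, i.e. it is the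
  counit of an adjunction between tensoring with \<open>X\<close> and \<open>Ihom X\<close>.
\<close>

locale closed_symmetric_monoidal_category = symmetric_monoidal_category +
  assumes ihom_obj: "X \<in> Obj E \<Longrightarrow> Y \<in> Obj E \<Longrightarrow> Ihom E X Y \<in> Obj E"
    and eval_hom: "X \<in> Obj E \<Longrightarrow> Y \<in> Obj E \<Longrightarrow> Eval E X Y \<in> hom E (Ihom E X Y \<otimes> X) Y"
    and eval_universal: "W \<in> Obj E \<Longrightarrow> X \<in> Obj E \<Longrightarrow> Y \<in> Obj E \<Longrightarrow> k \<in> hom E (W \<otimes> X) Y \<Longrightarrow>
      \<exists>!h. h \<in> hom E W (Ihom E X Y) \<and> Eval E X Y \<cdot> (h \<otimes>\<^sub>a Ident E X) = k"

definition transpose :: "('o, 'a, 'm) csm_cat_scheme \<Rightarrow> 'o \<Rightarrow> 'o \<Rightarrow> 'o \<Rightarrow> 'a \<Rightarrow> 'a" where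
  "transpose E W X Y k =
    (THE h. h \<in> hom E W (Ihom E X Y) \<and> Eval E X Y \<cdot>\<^bsub>E\<^esub> (h \<otimes>\<^sub>a\<^bsub>E\<^esub> Ident E X) = k)"

text \<open>\<open>ihom_pre E f Z\<close> is \<open>f\<^sup>* : Ihom Y Z \<rightarrow> Ihom X Z\<close> for \<open>f : X \<rightarrow> Y\<close>, and
  \<open>ihom_post E Z g\<close> is \<open>g\<^sub>* : Ihom Z U \<rightarrow> Ihom Z W\<close> for \<open>g : U \<rightarrow> W\<close>.\<close>

definition ihom_pre :: "('o, 'a, 'm) csm_cat_scheme \<Rightarrow> 'a \<Rightarrow> 'o \<Rightarrow> 'a" where
  "ihom_pre E f Z =
    transpose E (Ihom E (Cod E f) Z) (Dom E f) Z
      (Eval E (Cod E f) Z \<cdot>\<^bsub>E\<^esub> (Ident E (Ihom E (Cod E f) Z) \<otimes>\<^sub>a\<^bsub>E\<^esub> f))"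

definition ihom_post :: "('o, 'a, 'm) csm_cat_scheme \<Rightarrow> 'o \<Rightarrow> 'a \<Rightarrow> 'a" where
  "ihom_post E Z g =
    transpose E (Ihom E Z (Dom E g)) Z (Cod E g) (g \<cdot>\<^bsub>E\<^esub> Eval E Z (Dom E g))"

section \<open>Monoids and modules\<close>

locale monoid_in = monoidal_category +
  fixes R :: 'o and \<mu> :: 'a and \<eta> :: 'a
  assumes carrier_obj: "R \<in> Obj E"
    and mult_hom: "\<mu> \<in> hom E (R \<otimes> R) R"
    and unit_hom: "\<eta> \<in> hom E (Unit E) R"
    and mult_assoc: "\<mu> \<cdot> (\<mu> \<otimes>\<^sub>a Ident E R) = \<mu> \<cdot> (Ident E R \<otimes>\<^sub>a \<mu>) \<cdot> Assoc E R R R"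
    and mult_left_unit: "\<mu> \<cdot> (\<eta> \<otimes>\<^sub>a Ident E R) = Lunit E R"
    and mult_right_unit: "\<mu> \<cdot> (Ident E R \<otimes>\<^sub>a \<eta>) = Runit E R"

locale solid_monoid_in = monoid_in +
  assumes mult_iso: "iso E \<mu>"

definition is_module ::
  "('o, 'a, 'm) csm_cat_scheme \<Rightarrow> 'o \<Rightarrow> 'a \<Rightarrow> 'a \<Rightarrow> 'o \<times> 'a \<Rightarrow> bool" where
  "is_module E R \<mu> \<eta> = (\<lambda>(X, a). X \<in> Obj E \<and> a \<in> hom E (R \<otimes>\<^bsub>E\<^esub> X) X \<and>
    a \<cdot>\<^bsub>E\<^esub> (\<mu> \<otimes>\<^sub>a\<^bsub>E\<^esub> Ident E X) =
      a \<cdot>\<^bsub>E\<^esub> (Ident E R \<otimes>\<^sub>a\<^bsub>E\<^esub> a) \<cdot>\<^bsub>E\<^esub> Assoc E R R X \<and>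
    a \<cdot>\<^bsub>E\<^esub> (\<eta> \<otimes>\<^sub>a\<^bsub>E\<^esub> Ident E X) = Lunit E X)"

definition module_hom ::
  "('o, 'a, 'm) csm_cat_scheme \<Rightarrow> 'o \<Rightarrow> 'o \<times> 'a \<Rightarrow> 'o \<times> 'a \<Rightarrow> 'a set" where
  "module_hom E R = (\<lambda>(X, a) (Y, b).
    {f \<in> hom E X Y. f \<cdot>\<^bsub>E\<^esub> a = b \<cdot>\<^bsub>E\<^esub> (Ident E R \<otimes>\<^sub>a\<^bsub>E\<^esub> f)})"

text \<open>
  An arrow of the module category carries its source and target module, since the same
  underlying arrow of \<open>E\<close> may be a homomorphism for several module structures.
\<close>

definition module_category ::
  "('o, 'a, 'm) csm_cat_scheme \<Rightarrow> 'o \<Rightarrow> 'a \<Rightarrow> 'a \<Rightarrow>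
    ('o \<times> 'a, ('o \<times> 'a) \<times> 'a \<times> ('o \<times> 'a)) cat" where
  "module_category E R \<mu> \<eta> =
    \<lparr>Obj = {M. is_module E R \<mu> \<eta> M},
     Arr = {(M, f, N). is_module E R \<mu> \<eta> M \<and> is_module E R \<mu> \<eta> N \<and> f \<in> module_hom E R M N},
     Dom = (\<lambda>(M, f, N). M),
     Cod = (\<lambda>(M, f, N). N),
     Ident = (\<lambda>M. (M, Ident E (fst M), M)),
     Comp = (\<lambda>(N, g, P) (M, f, N'). (M, g \<cdot>\<^bsub>E\<^esub> f, P))\<rparr>"

section \<open>Localizations and colocalizations\<close>

definition localization_functor ::
  "('o, 'a, 'm) cat_scheme \<Rightarrow> ('o, 'a, 'o, 'a) fun_data \<Rightarrow> ('o \<Rightarrow> 'a) \<Rightarrow> bool" where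
  "localization_functor C L l \<longleftrightarrow> is_functor C C L \<and> nat_trans C C id_fun L l \<and>
    (\<forall>X \<in> Obj C. l (Fobj L X) = Farr L (l X) \<and> iso C (l (Fobj L X)))"

definition colocalization_functor ::
  "('o, 'a, 'm) cat_scheme \<Rightarrow> ('o, 'a, 'o, 'a) fun_data \<Rightarrow> ('o \<Rightarrow> 'a) \<Rightarrow> bool" where
  "colocalization_functor C K c \<longleftrightarrow> is_functor C C K \<and> nat_trans C C K id_fun c \<and>
    (\<forall>X \<in> Obj C. c (Fobj K X) = Farr K (c X) \<and> iso C (c (Fobj K X)))"

text \<open>
  The next two notions are shared: for a localization functor they are its local objects and
  local equivalences, for a colocalization functor its colocal objects and colocal equivalences.
\<close>

definition image_objects ::
  "('o, 'a, 'm) cat_scheme \<Rightarrow> ('o, 'a, 'o, 'a) fun_data \<Rightarrow> 'o set" where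
  "image_objects C L = {Z \<in> Obj C. \<exists>X \<in> Obj C. isomorphic C Z (Fobj L X)}"

definition inverted_arrows ::
  "('o, 'a, 'm) cat_scheme \<Rightarrow> ('o, 'a, 'o, 'a) fun_data \<Rightarrow> 'a set" where
  "inverted_arrows C L = {f \<in> Arr C. iso C (Farr L f)}"

definition R_equivalences :: "('o, 'a, 'm) csm_cat_scheme \<Rightarrow> 'o \<Rightarrow> 'a set" where
  "R_equivalences E R = {f \<in> Arr E. iso E (Ident E R \<otimes>\<^sub>a\<^bsub>E\<^esub> f)}"

definition R_local_objects :: "('o, 'a, 'm) csm_cat_scheme \<Rightarrow> 'o \<Rightarrow> 'o set" where
  "R_local_objects E R = {Z \<in> Obj E. \<forall>f \<in> R_equivalences E R. iso E (ihom_pre E f Z)}"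

definition R_colocal_equivalences :: "('o, 'a, 'm) csm_cat_scheme \<Rightarrow> 'o \<Rightarrow> 'a set" where
  "R_colocal_equivalences E R = {g \<in> Arr E. iso E (ihom_post E R g)}"

definition R_colocal_objects :: "('o, 'a, 'm) csm_cat_scheme \<Rightarrow> 'o \<Rightarrow> 'o set" where
  "R_colocal_objects E R = {Z \<in> Obj E. \<forall>g \<in> R_colocal_equivalences E R. iso E (ihom_post E Z g)}"

definition is_L_R ::
  "('o, 'a, 'm) csm_cat_scheme \<Rightarrow> 'o \<Rightarrow> ('o, 'a, 'o, 'a) fun_data \<Rightarrow> ('o \<Rightarrow> 'a) \<Rightarrow> bool" where
  "is_L_R E R L l \<longleftrightarrow> localization_functor E L l \<and>
    image_objects E L = R_local_objects E R \<and> inverted_arrows E L = R_equivalences E R"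

definition is_C_R ::
  "('o, 'a, 'm) csm_cat_scheme \<Rightarrow> 'o \<Rightarrow> ('o, 'a, 'o, 'a) fun_data \<Rightarrow> ('o \<Rightarrow> 'a) \<Rightarrow> bool" where
  "is_C_R E R C c \<longleftrightarrow> colocalization_functor E C c \<and>
    image_objects E C = R_colocal_objects E R \<and> inverted_arrows E C = R_colocal_equivalences E R"

end

theory Submission
  imports Defs
begin

text \<open>
  The unit \<open>\<eta>\<close> of the monoid gives every object \<open>X\<close> a natural arrow
  \<open>u\<^sub>X : X \<rightarrow> R \<otimes> X\<close> (\<open>free_unit\<close>). Call \<open>X\<close> stable if \<open>u\<^sub>X\<close> is invertible. The three
  categories of the theorem coincide because each of them is, up to a uniquely determined module
  structure, the full subcategory of stable objects.

  Both \<open>R \<otimes> u\<^sub>X\<close> and \<open>u\<close> at \<open>R \<otimes> X\<close> are sections of the multiplication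
  \<open>R \<otimes> (R \<otimes> X) \<rightarrow> R \<otimes> X\<close>. When the monoid is solid this multiplication is invertible, so the two
  arrows agree (\<open>free_unit_well_pointed\<close>) and are isomorphisms: \<open>R \<otimes> -\<close> is an idempotent monad.
  The consequence on which everything rests is \<open>split_free_unit_iso\<close>: as soon as \<open>u\<^sub>X\<close> has a left
  inverse, it is an isomorphism.

  \<^item> A module structure on \<open>X\<close> is in particular a left inverse of \<open>u\<^sub>X\<close>. Hence \<open>X\<close> is stable and
    the structure is the inverse of \<open>u\<^sub>X\<close>; conversely that inverse is associative, and every
    arrow between stable objects is linear because \<open>u\<close> is natural (\<open>module_iff_stable\<close>,
    \<open>module_hom_stable\<close>).
  \<^item> The arrow \<open>u\<^sub>Z\<close> is an \<open>R\<close>-equivalence. If \<open>Z\<close> is local, the identity of \<open>Z\<close> therefore extends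
    along \<open>u\<^sub>Z\<close> to a left inverse of \<open>u\<^sub>Z\<close>. Conversely, arrows into a stable object extend uniquely
    along any \<open>R\<close>-equivalence (\<open>R_local_iff_stable\<close>).
  \<^item> Evaluation at the unit, \<open>Ihom R Z \<rightarrow> Z\<close>, is an \<open>R\<close>-colocal equivalence. If \<open>Z\<close> is colocal, the
    identity of \<open>Z\<close> lifts to \<open>Z \<rightarrow> Ihom R Z\<close>, and uncurrying turns this lift into a left inverse of
    \<open>u\<^sub>Z\<close>. Conversely, if \<open>Z\<close> is stable then \<open>A \<otimes> Z\<close> is isomorphic to \<open>(Z \<otimes> A) \<otimes> R\<close>, so mapping
    out of \<open>A \<otimes> Z\<close> inverts the \<open>R\<close>-colocal equivalences (\<open>R_colocal_iff_stable\<close>).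

  So the images of the localization and of the colocalization are both the class of stable objects.
  The resulting equivalences are in fact isomorphisms of categories, the forgetful functor being one half.
\<close>

section \<open>Isomorphisms and bijections on hom-sets\<close>

text \<open>
  In a commutative square of maps whose two vertical sides are bijections, one horizontal side is
  bijective exactly if the other is. Currying provides such vertical sides below.
\<close>

lemma bij_betw_square:
  assumes d: "bij_betw d S T" and c: "bij_betw c S' T'"
    and p: "\<And>x. x \<in> S \<Longrightarrow> p x \<in> S'"
    and eq: "\<And>x. x \<in> S \<Longrightarrow> c (p x) = q (d x)"
  shows "bij_betw p S S' \<longleftrightarrow> bij_betw q T T'"
proof -
  have "bij_betw p S S' \<longleftrightarrow> bij_betw (c \<circ> p) S T'"
    by (rule bij_betw_comp_iff2[OF c]) (use p in blast)
  also have "\<dots> \<longleftrightarrow> bij_betw (q \<circ> d) S T'"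
    by (rule bij_betw_cong) (use eq in simp)
  also have "\<dots> \<longleftrightarrow> bij_betw q T T'"
    by (rule bij_betw_comp_iff[OF d, symmetric])
  finally show ?thesis .
qed

lemma hom_iff: "f \<in> hom C X Y \<longleftrightarrow> f \<in> Arr C \<and> Dom C f = X \<and> Cod C f = Y"
  by (auto simp: hom_def)

lemma iso_arr: "iso C f \<Longrightarrow> f \<in> Arr C"
  by (simp add: iso_def)

context category
begin

lemma comp_arr [simp]:
  assumes "f \<in> Arr C" "g \<in> Arr C" "Dom C g = Cod C f"
  shows "g \<cdot> f \<in> Arr C" "Dom C (g \<cdot> f) = Dom C f" "Cod C (g \<cdot> f) = Cod C g"
  using comp_hom[of f "Dom C f" "Cod C f" g "Cod C g"] assms by (auto simp: hom_iff)

lemma ident_arr [simp]: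
  assumes "X \<in> Obj C"
  shows "Ident C X \<in> Arr C" "Dom C (Ident C X) = X" "Cod C (Ident C X) = X"
  using ident_hom[OF assms] by (auto simp: hom_iff)

lemma ident_absorb [simp]:
  assumes "f \<in> Arr C"
  shows "Dom C f = X \<Longrightarrow> f \<cdot> Ident C X = f" "Cod C f = Y \<Longrightarrow> Ident C Y \<cdot> f = f"
  using comp_ident[of f X "Cod C f"] ident_comp[of f "Dom C f" Y] assms by (auto simp: hom_iff)

lemma assoc:
  assumes "f \<in> Arr C" "g \<in> Arr C" "h \<in> Arr C" "Dom C h = Cod C g" "Dom C g = Cod C f"
  shows "(h \<cdot> g) \<cdot> f = h \<cdot> (g \<cdot> f)"
  using comp_assoc[of f "Dom C f" "Cod C f" g "Cod C g" h "Cod C h"] assms by (auto simp: hom_iff)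

declare dom_in_Obj [simp] cod_in_Obj [simp]

lemma hom_obj: "f \<in> hom C X Y \<Longrightarrow> X \<in> Obj C" "f \<in> hom C X Y \<Longrightarrow> Y \<in> Obj C"
  by (auto simp: hom_iff)

definition inverse_arrow :: "'a \<Rightarrow> 'a" where
  "inverse_arrow f = (SOME g. g \<in> hom C (Cod C f) (Dom C f) \<and>
     g \<cdot> f = Ident C (Dom C f) \<and> f \<cdot> g = Ident C (Cod C f))"

lemma inverse_arrow:
  assumes "iso C f"
  shows "inverse_arrow f \<in> Arr C" "Dom C (inverse_arrow f) = Cod C f"
    "Cod C (inverse_arrow f) = Dom C f"
    "inverse_arrow f \<cdot> f = Ident C (Dom C f)" "f \<cdot> inverse_arrow f = Ident C (Cod C f)"
proof -
  have "inverse_arrow f \<in> hom C (Cod C f) (Dom C f) \<and>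
     inverse_arrow f \<cdot> f = Ident C (Dom C f) \<and> f \<cdot> inverse_arrow f = Ident C (Cod C f)"
    unfolding inverse_arrow_def by (rule someI_ex) (use assms in \<open>auto simp: iso_def\<close>)
  then show "inverse_arrow f \<in> Arr C" "Dom C (inverse_arrow f) = Cod C f"
    "Cod C (inverse_arrow f) = Dom C f"
    "inverse_arrow f \<cdot> f = Ident C (Dom C f)" "f \<cdot> inverse_arrow f = Ident C (Cod C f)"
    by (auto simp: hom_iff)
qed

lemma inverse_arrow_cancel:
  assumes "iso C f" "h \<in> Arr C"
  shows "Cod C h = Dom C f \<Longrightarrow> inverse_arrow f \<cdot> (f \<cdot> h) = h"
    "Cod C h = Cod C f \<Longrightarrow> f \<cdot> (inverse_arrow f \<cdot> h) = h"
  using assms inverse_arrow[OF assms(1)] iso_arr[OF assms(1)]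
  by (simp_all add: assoc[symmetric])

lemma isoI:
  assumes "f \<in> Arr C" "g \<in> Arr C" "Dom C g = Cod C f" "Cod C g = Dom C f"
    "g \<cdot> f = Ident C (Dom C f)" "f \<cdot> g = Ident C (Cod C f)"
  shows "iso C f"
  using assms unfolding iso_def by (auto simp: hom_iff)

lemma iso_inverse_arrow:
  assumes "iso C f"
  shows "iso C (inverse_arrow f)"
  by (rule isoI[where g = f]) (use inverse_arrow[OF assms] iso_arr[OF assms] in simp_all)

lemma iso_ident: "X \<in> Obj C \<Longrightarrow> iso C (Ident C X)"
  by (rule isoI[where g = "Ident C X"]) simp_all

lemma iso_comp:
  assumes f: "iso C f" and g: "iso C g" and fg: "Dom C g = Cod C f"
  shows "iso C (g \<cdot> f)"
proof (rule isoI[where g = "inverse_arrow f \<cdot> inverse_arrow g"])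
  note * = inverse_arrow[OF f] inverse_arrow[OF g] iso_arr[OF f] iso_arr[OF g] fg
  show "(inverse_arrow f \<cdot> inverse_arrow g) \<cdot> (g \<cdot> f) = Ident C (Dom C (g \<cdot> f))"
    using * by (simp add: assoc inverse_arrow_cancel[OF g])
  show "(g \<cdot> f) \<cdot> (inverse_arrow f \<cdot> inverse_arrow g) = Ident C (Cod C (g \<cdot> f))"
    using * by (simp add: assoc inverse_arrow_cancel[OF f])
qed (use inverse_arrow[OF f] inverse_arrow[OF g] iso_arr[OF f] iso_arr[OF g] fg in simp_all)

lemma iso_cancel_left:
  assumes "iso C p" "f \<in> Arr C" "g \<in> Arr C" "Cod C f = Dom C p" "Cod C g = Dom C p"
    "p \<cdot> f = p \<cdot> g"
  shows "f = g"
  using assms inverse_arrow_cancel(1)[of p f] inverse_arrow_cancel(1)[of p g] by metis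

lemma iso_cancel_right:
  assumes p: "iso C p" and "f \<in> Arr C" "g \<in> Arr C" "Dom C f = Cod C p" "Dom C g = Cod C p"
    "f \<cdot> p = g \<cdot> p"
  shows "f = g"
proof -
  have "(f \<cdot> p) \<cdot> inverse_arrow p = (g \<cdot> p) \<cdot> inverse_arrow p"
    using assms by simp
  then show ?thesis
    using assms(2-5) inverse_arrow[OF p] iso_arr[OF p] by (simp add: assoc)
qed

lemma left_inverse_iso:
  assumes p: "iso C p" and q: "q \<in> Arr C" "Dom C q = Cod C p" "Cod C q = Dom C p"
    and qp: "q \<cdot> p = Ident C (Dom C p)"
  shows "q = inverse_arrow p"
  by (rule iso_cancel_right[OF p]) (use inverse_arrow[OF p] q qp in simp_all)

lemma iso_if_comp_ident:
  assumes p: "iso C p" and q: "q \<in> Arr C" "Dom C p = Cod C q" "Cod C p = Dom C q"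
    and pq: "p \<cdot> q = Ident C (Dom C q)"
  shows "iso C q"
proof -
  have "q = inverse_arrow p"
    by (rule iso_cancel_left[OF p]) (use inverse_arrow[OF p] q pq in simp_all)
  then show ?thesis
    using iso_inverse_arrow[OF p] by simp
qed

lemma iso_conjugate:
  assumes f: "iso C f" and p: "iso C p" and q: "iso C q"
    and g: "g \<in> Arr C" "Dom C p = Dom C f" "Cod C p = Dom C g" "Dom C q = Cod C f"
      "Cod C q = Cod C g"
    and eq: "g \<cdot> p = q \<cdot> f"
  shows "iso C g"
proof -
  have "g = q \<cdot> f \<cdot> inverse_arrow p"
    by (rule iso_cancel_right[OF p])
      (use eq inverse_arrow[OF p] iso_arr[OF p] iso_arr[OF q] iso_arr[OF f] g in
        \<open>simp_all add: assoc\<close>)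
  also have "iso C \<dots>"
    using iso_inverse_arrow[OF p] inverse_arrow[OF p] iso_arr[OF p] iso_arr[OF q] iso_arr[OF f] g
    by (intro iso_comp f q) simp_all
  finally show ?thesis .
qed

lemma iso_iff_bij_post_comp:
  assumes p: "p \<in> hom C P Q"
  shows "iso C p \<longleftrightarrow> (\<forall>A\<in>Obj C. bij_betw (\<lambda>h. p \<cdot> h) (hom C A P) (hom C A Q))"
proof
  assume i: "iso C p"
  note ii = inverse_arrow[OF i] inverse_arrow_cancel[OF i]
  show "\<forall>A\<in>Obj C. bij_betw (\<lambda>h. p \<cdot> h) (hom C A P) (hom C A Q)"
    by (intro ballI bij_betw_byWitness[where f' = "\<lambda>h. inverse_arrow p \<cdot> h"])
      (use p ii in \<open>auto simp: hom_iff\<close>)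
next
  assume bij: "\<forall>A\<in>Obj C. bij_betw (\<lambda>h. p \<cdot> h) (hom C A P) (hom C A Q)"
  have PQ: "P \<in> Obj C" "Q \<in> Obj C"
    using hom_obj[OF p] by auto
  have "Ident C Q \<in> (\<lambda>h. p \<cdot> h) ` hom C Q P"
    using bij PQ ident_hom[of Q] by (auto simp: bij_betw_def)
  then obtain q where q: "q \<in> hom C Q P" "p \<cdot> q = Ident C Q"
    by auto
  have "inj_on (\<lambda>h. p \<cdot> h) (hom C P P)"
    using bij PQ by (auto simp: bij_betw_def)
  then have "q \<cdot> p = Ident C P"
    by (rule inj_onD) (use p q PQ in \<open>auto simp: hom_iff assoc[symmetric]\<close>)
  then show "iso C p"
    using p q by (intro isoI[where g = q]) (auto simp: hom_iff)
qed

lemma bij_pre_comp_iso: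
  assumes i: "iso C i" and d: "Dom C i = B" "Cod C i = A"
  shows "bij_betw (\<lambda>h. h \<cdot> i) (hom C A Z) (hom C B Z)"
  using inverse_arrow[OF i] iso_arr[OF i] d
  by (intro bij_betw_byWitness[where f' = "\<lambda>h. h \<cdot> inverse_arrow i"])
     (auto simp: hom_iff assoc)

text \<open>
  Precomposition with an isomorphism \<open>B \<rightarrow> A\<close> commutes with postcomposition with \<open>g\<close>, so the class
  of objects that see \<open>g\<close> as an isomorphism is closed under isomorphism.
\<close>

lemma bij_post_comp_transfer:
  assumes i: "iso C i" and d: "Dom C i = B" "Cod C i = A" and g: "g \<in> hom C U W"
    and bij: "bij_betw (\<lambda>h. g \<cdot> h) (hom C A U) (hom C A W)"
  shows "bij_betw (\<lambda>h. g \<cdot> h) (hom C B U) (hom C B W)"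
proof -
  have "bij_betw (\<lambda>h. g \<cdot> h) (hom C A U) (hom C A W) \<longleftrightarrow>
      bij_betw (\<lambda>h. g \<cdot> h) (hom C B U) (hom C B W)"
    by (rule bij_betw_square[OF bij_pre_comp_iso[OF i d] bij_pre_comp_iso[OF i d]])
      (use g iso_arr[OF i] d in \<open>auto simp: hom_iff assoc\<close>)
  with bij show ?thesis by simp
qed

end

section \<open>Tensor products and internal homs\<close>

context monoidal_category
begin

lemma tensor_arr [simp]:
  assumes "f \<in> Arr E" "g \<in> Arr E"
  shows "f \<otimes>\<^sub>a g \<in> Arr E" "Dom E (f \<otimes>\<^sub>a g) = Dom E f \<otimes> Dom E g"
    "Cod E (f \<otimes>\<^sub>a g) = Cod E f \<otimes> Cod E g"
  using tensor_hom[of f "Dom E f" "Cod E f" g "Dom E g" "Cod E g"] assms by (auto simp: hom_iff)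

lemma interchange:
  assumes "f \<in> Arr E" "g \<in> Arr E" "f' \<in> Arr E" "g' \<in> Arr E" "Dom E f' = Cod E f" "Dom E g' = Cod E g"
  shows "(f' \<otimes>\<^sub>a g') \<cdot> (f \<otimes>\<^sub>a g) = (f' \<cdot> f) \<otimes>\<^sub>a (g' \<cdot> g)"
  using tensor_comp[of f "Dom E f" "Cod E f" f' "Cod E f'" g "Dom E g" "Cod E g" g' "Cod E g'"] assms
  by (auto simp: hom_iff)

declare tensor_ident [simp] unit_obj [simp] tensor_obj [simp]

lemma structure_arr [simp]:
  shows "\<lbrakk>X \<in> Obj E; Y \<in> Obj E; Z \<in> Obj E\<rbrakk> \<Longrightarrow> Assoc E X Y Z \<in> Arr E"
    "\<lbrakk>X \<in> Obj E; Y \<in> Obj E; Z \<in> Obj E\<rbrakk> \<Longrightarrow> Dom E (Assoc E X Y Z) = (X \<otimes> Y) \<otimes> Z"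
    "\<lbrakk>X \<in> Obj E; Y \<in> Obj E; Z \<in> Obj E\<rbrakk> \<Longrightarrow> Cod E (Assoc E X Y Z) = X \<otimes> (Y \<otimes> Z)"
    "X \<in> Obj E \<Longrightarrow> Lunit E X \<in> Arr E"
    "X \<in> Obj E \<Longrightarrow> Dom E (Lunit E X) = Unit E \<otimes> X"
    "X \<in> Obj E \<Longrightarrow> Cod E (Lunit E X) = X"
    "X \<in> Obj E \<Longrightarrow> Runit E X \<in> Arr E"
    "X \<in> Obj E \<Longrightarrow> Dom E (Runit E X) = X \<otimes> Unit E"
    "X \<in> Obj E \<Longrightarrow> Cod E (Runit E X) = X"
  using assoc_hom[of X Y Z] lunit_hom[of X] runit_hom[of X] by (auto simp: hom_iff)

lemma assoc_nat:
  assumes "f \<in> Arr E" "g \<in> Arr E" "h \<in> Arr E"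
  shows "Assoc E (Cod E f) (Cod E g) (Cod E h) \<cdot> ((f \<otimes>\<^sub>a g) \<otimes>\<^sub>a h)
    = (f \<otimes>\<^sub>a (g \<otimes>\<^sub>a h)) \<cdot> Assoc E (Dom E f) (Dom E g) (Dom E h)"
  using assms by (intro assoc_natural) (auto simp: hom_iff)

lemma lunit_nat:
  assumes "f \<in> Arr E"
  shows "Lunit E (Cod E f) \<cdot> (Ident E (Unit E) \<otimes>\<^sub>a f) = f \<cdot> Lunit E (Dom E f)"
  using assms by (intro lunit_natural) (auto simp: hom_iff)

lemma iso_tensor:
  assumes f: "iso E f" and g: "iso E g"
  shows "iso E (f \<otimes>\<^sub>a g)"
  by (rule isoI[where g = "inverse_arrow f \<otimes>\<^sub>a inverse_arrow g"])
    (use inverse_arrow[OF f] inverse_arrow[OF g] iso_arr[OF f] iso_arr[OF g] in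
      \<open>simp_all add: interchange\<close>)

text \<open>The left unitor is natural and invertible, so \<open>I \<otimes> -\<close> is isomorphic to the identity.\<close>

lemma unit_tensor_faithful:
  assumes "f \<in> Arr E" "g \<in> Arr E" "Dom E f = Dom E g" "Cod E f = Cod E g"
    and "Ident E (Unit E) \<otimes>\<^sub>a f = Ident E (Unit E) \<otimes>\<^sub>a g"
  shows "f = g"
proof -
  have "f \<cdot> Lunit E (Dom E f) = g \<cdot> Lunit E (Dom E f)"
    using lunit_nat[of f] lunit_nat[of g] assms by simp
  then show ?thesis
    by (rule iso_cancel_right[rotated -1]) (use assms in \<open>auto intro: lunit_iso\<close>)
qed

text \<open>
  Kelly's observation that the compatibility of the left unitor with the associator follows from
  the pentagon and the triangle. Tensoring with the unit is faithful, so it is enough to compare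
  both sides inside \<open>I \<otimes> -\<close>, where the pentagon for \<open>I, I, X, Y\<close> and two triangles apply.
\<close>

lemma lunit_tensor:
  assumes X: "X \<in> Obj E" and Y: "Y \<in> Obj E"
  shows "Lunit E (X \<otimes> Y) \<cdot> Assoc E (Unit E) X Y = Lunit E X \<otimes>\<^sub>a Ident E Y"
proof (rule unit_tensor_faithful)
  let ?I = "Unit E" and ?i = "Ident E (Unit E)"
  let ?p = "Assoc E ?I (?I \<otimes> X) Y \<cdot> (Assoc E ?I ?I X \<otimes>\<^sub>a Ident E Y)"
  let ?f = "?i \<otimes>\<^sub>a (Lunit E (X \<otimes> Y) \<cdot> Assoc E ?I X Y)"
  let ?g = "?i \<otimes>\<^sub>a (Lunit E X \<otimes>\<^sub>a Ident E Y)"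
  have p: "iso E ?p"
    using X Y by (intro iso_comp iso_tensor assoc_iso iso_ident) simp_all
  have "?f \<cdot> ?p = (?i \<otimes>\<^sub>a Lunit E (X \<otimes> Y)) \<cdot>
      ((?i \<otimes>\<^sub>a Assoc E ?I X Y) \<cdot> Assoc E ?I (?I \<otimes> X) Y \<cdot> (Assoc E ?I ?I X \<otimes>\<^sub>a Ident E Y))"
    using X Y by (simp add: interchange assoc[symmetric])
  also have "\<dots> = ((?i \<otimes>\<^sub>a Lunit E (X \<otimes> Y)) \<cdot> Assoc E ?I ?I (X \<otimes> Y)) \<cdot> Assoc E (?I \<otimes> ?I) X Y"
    using X Y by (simp add: pentagon[symmetric] assoc)
  also have "\<dots> = (Runit E ?I \<otimes>\<^sub>a Ident E (X \<otimes> Y)) \<cdot> Assoc E (?I \<otimes> ?I) X Y"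
    using X Y by (simp add: triangle)
  also have "\<dots> = Assoc E ?I X Y \<cdot> ((Runit E ?I \<otimes>\<^sub>a Ident E X) \<otimes>\<^sub>a Ident E Y)"
    using X Y assoc_nat[of "Runit E ?I" "Ident E X" "Ident E Y"] by simp
  also have "\<dots> = Assoc E ?I X Y \<cdot> (((?i \<otimes>\<^sub>a Lunit E X) \<cdot> Assoc E ?I ?I X) \<otimes>\<^sub>a Ident E Y)"
    using X Y by (simp add: triangle)
  also have "\<dots> = (Assoc E ?I X Y \<cdot> ((?i \<otimes>\<^sub>a Lunit E X) \<otimes>\<^sub>a Ident E Y)) \<cdot>
      (Assoc E ?I ?I X \<otimes>\<^sub>a Ident E Y)"
    using X Y by (simp add: assoc interchange)
  also have "\<dots> = ?g \<cdot> ?p"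
    using X Y assoc_nat[of ?i "Lunit E X" "Ident E Y"] by (simp add: assoc)
  finally show "?f = ?g"
    by (rule iso_cancel_right[OF p, rotated -1]) (use X Y in simp_all)
qed (use X Y in simp_all)

end

context symmetric_monoidal_category
begin

lemma braid_arr [simp]:
  assumes "X \<in> Obj E" "Y \<in> Obj E"
  shows "Braid E X Y \<in> Arr E" "Dom E (Braid E X Y) = X \<otimes> Y" "Cod E (Braid E X Y) = Y \<otimes> X"
  using braid_hom[OF assms] by (auto simp: hom_iff)

lemma braid_nat:
  assumes "f \<in> Arr E" "g \<in> Arr E"
  shows "Braid E (Cod E f) (Cod E g) \<cdot> (f \<otimes>\<^sub>a g) = (g \<otimes>\<^sub>a f) \<cdot> Braid E (Dom E f) (Dom E g)"
  using assms by (intro braid_natural) (auto simp: hom_iff)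

lemma braid_iso: "X \<in> Obj E \<Longrightarrow> Y \<in> Obj E \<Longrightarrow> iso E (Braid E X Y)"
  by (rule isoI[where g = "Braid E Y X"]) (simp_all add: braid_symmetric)

end

context closed_symmetric_monoidal_category
begin

declare ihom_obj [simp]

lemma eval_arr [simp]:
  assumes "X \<in> Obj E" "Y \<in> Obj E"
  shows "Eval E X Y \<in> Arr E" "Dom E (Eval E X Y) = Ihom E X Y \<otimes> X" "Cod E (Eval E X Y) = Y"
  using eval_hom[OF assms] by (auto simp: hom_iff)

lemma bij_uncurry:
  assumes "W \<in> Obj E" "X \<in> Obj E" "Y \<in> Obj E"
  shows "bij_betw (\<lambda>h. Eval E X Y \<cdot> (h \<otimes>\<^sub>a Ident E X)) (hom E W (Ihom E X Y)) (hom E (W \<otimes> X) Y)"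
proof -
  let ?u = "\<lambda>h. Eval E X Y \<cdot> (h \<otimes>\<^sub>a Ident E X)"
  have maps: "?u h \<in> hom E (W \<otimes> X) Y" if "h \<in> hom E W (Ihom E X Y)" for h
    using that assms by (auto simp: hom_iff)
  have ex1: "\<exists>!h. h \<in> hom E W (Ihom E X Y) \<and> ?u h = k" if "k \<in> hom E (W \<otimes> X) Y" for k
    using eval_universal[OF assms that] .
  show ?thesis
    unfolding bij_betw_def inj_on_def using maps ex1 by (auto simp: image_iff) metis+
qed

lemma transpose:
  assumes "W \<in> Obj E" "X \<in> Obj E" "Y \<in> Obj E" "k \<in> hom E (W \<otimes> X) Y"
  shows "transpose E W X Y k \<in> hom E W (Ihom E X Y)"
    "Eval E X Y \<cdot> (transpose E W X Y k \<otimes>\<^sub>a Ident E X) = k"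
  using theI'[OF eval_universal[OF assms]] unfolding transpose_def by auto

text \<open>
  By the Yoneda lemma and currying, invertibility of a map between internal homs can be tested on
  ordinary hom-sets, at the cost of tensoring with a parameter object \<open>A\<close>.
\<close>

lemma iso_ihom_pre_iff:
  assumes f: "f \<in> hom E X Y" and Z: "Z \<in> Obj E"
  shows "iso E (ihom_pre E f Z) \<longleftrightarrow>
    (\<forall>A\<in>Obj E. bij_betw (\<lambda>h. h \<cdot> (Ident E A \<otimes>\<^sub>a f)) (hom E (A \<otimes> Y) Z) (hom E (A \<otimes> X) Z))"
proof -
  have XY: "X \<in> Obj E" "Y \<in> Obj E" using hom_obj[OF f] by auto
  let ?H = "Ihom E Y Z"
  let ?k = "Eval E Y Z \<cdot> (Ident E ?H \<otimes>\<^sub>a f)"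
  have k: "?k \<in> hom E (?H \<otimes> X) Z"
    using f Z XY by (auto simp: hom_iff)
  have eq: "ihom_pre E f Z = transpose E ?H X Z ?k"
    using f by (auto simp: ihom_pre_def hom_iff)
  have p: "ihom_pre E f Z \<in> hom E ?H (Ihom E X Z)"
    and ev: "Eval E X Z \<cdot> (ihom_pre E f Z \<otimes>\<^sub>a Ident E X) = ?k"
    using transpose[OF _ _ _ k] XY Z by (auto simp: eq)
  have "bij_betw (\<lambda>h. ihom_pre E f Z \<cdot> h) (hom E A ?H) (hom E A (Ihom E X Z)) \<longleftrightarrow>
      bij_betw (\<lambda>h. h \<cdot> (Ident E A \<otimes>\<^sub>a f)) (hom E (A \<otimes> Y) Z) (hom E (A \<otimes> X) Z)"
    if A: "A \<in> Obj E" for A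
  proof (rule bij_betw_square[OF bij_uncurry bij_uncurry])
    fix h assume h: "h \<in> hom E A ?H"
    show "ihom_pre E f Z \<cdot> h \<in> hom E A (Ihom E X Z)"
      using comp_hom[OF h p] .
    have "Eval E X Z \<cdot> ((ihom_pre E f Z \<cdot> h) \<otimes>\<^sub>a Ident E X)
        = (Eval E X Z \<cdot> (ihom_pre E f Z \<otimes>\<^sub>a Ident E X)) \<cdot> (h \<otimes>\<^sub>a Ident E X)"
      using h p XY Z by (auto simp: hom_iff assoc interchange)
    also have "\<dots> = (Eval E Y Z \<cdot> (h \<otimes>\<^sub>a Ident E Y)) \<cdot> (Ident E A \<otimes>\<^sub>a f)"
      unfolding ev using h f A XY Z by (auto simp: hom_iff assoc interchange)
    finally show "Eval E X Z \<cdot> ((ihom_pre E f Z \<cdot> h) \<otimes>\<^sub>a Ident E X) =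
      (Eval E Y Z \<cdot> (h \<otimes>\<^sub>a Ident E Y)) \<cdot> (Ident E A \<otimes>\<^sub>a f)" .
  qed (use A XY Z in simp_all)
  then show ?thesis
    unfolding iso_iff_bij_post_comp[OF p] by auto
qed

lemma iso_ihom_post_iff:
  assumes g: "g \<in> hom E U W" and Z: "Z \<in> Obj E"
  shows "iso E (ihom_post E Z g) \<longleftrightarrow>
    (\<forall>A\<in>Obj E. bij_betw (\<lambda>h. g \<cdot> h) (hom E (A \<otimes> Z) U) (hom E (A \<otimes> Z) W))"
proof -
  have UW: "U \<in> Obj E" "W \<in> Obj E" using hom_obj[OF g] by auto
  let ?H = "Ihom E Z U"
  let ?k = "g \<cdot> Eval E Z U"
  have k: "?k \<in> hom E (?H \<otimes> Z) W"
    using g Z UW by (auto simp: hom_iff)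
  have eq: "ihom_post E Z g = transpose E ?H Z W ?k"
    using g by (auto simp: ihom_post_def hom_iff)
  have p: "ihom_post E Z g \<in> hom E ?H (Ihom E Z W)"
    and ev: "Eval E Z W \<cdot> (ihom_post E Z g \<otimes>\<^sub>a Ident E Z) = ?k"
    using transpose[OF _ _ _ k] UW Z by (auto simp: eq)
  have "bij_betw (\<lambda>h. ihom_post E Z g \<cdot> h) (hom E A ?H) (hom E A (Ihom E Z W)) \<longleftrightarrow>
      bij_betw (\<lambda>h. g \<cdot> h) (hom E (A \<otimes> Z) U) (hom E (A \<otimes> Z) W)"
    if A: "A \<in> Obj E" for A
  proof (rule bij_betw_square[OF bij_uncurry bij_uncurry])
    fix h assume h: "h \<in> hom E A ?H"
    show "ihom_post E Z g \<cdot> h \<in> hom E A (Ihom E Z W)"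
      using comp_hom[OF h p] .
    have "Eval E Z W \<cdot> ((ihom_post E Z g \<cdot> h) \<otimes>\<^sub>a Ident E Z)
        = (Eval E Z W \<cdot> (ihom_post E Z g \<otimes>\<^sub>a Ident E Z)) \<cdot> (h \<otimes>\<^sub>a Ident E Z)"
      using h p UW Z by (auto simp: hom_iff assoc interchange)
    also have "\<dots> = g \<cdot> (Eval E Z U \<cdot> (h \<otimes>\<^sub>a Ident E Z))"
      unfolding ev using h g A UW Z by (auto simp: hom_iff assoc interchange)
    finally show "Eval E Z W \<cdot> ((ihom_post E Z g \<cdot> h) \<otimes>\<^sub>a Ident E Z) =
      g \<cdot> (Eval E Z U \<cdot> (h \<otimes>\<^sub>a Ident E Z))" .
  qed (use A UW Z in simp_all)
  then show ?thesis
    unfolding iso_iff_bij_post_comp[OF p] by auto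
qed

end

section \<open>The idempotent functor given by a solid monoid\<close>

context monoid_in
begin

definition free_unit :: "'o \<Rightarrow> 'a" where
  "free_unit X = (\<eta> \<otimes>\<^sub>a Ident E X) \<cdot> inverse_arrow (Lunit E X)"

definition stable_objects :: "'o set" where
  "stable_objects = {X \<in> Obj E. iso E (free_unit X)}"

definition free_mult :: "'o \<Rightarrow> 'a" where
  "free_mult X = (\<mu> \<otimes>\<^sub>a Ident E X) \<cdot> inverse_arrow (Assoc E R R X)"

lemma monoid_arr [simp]:
  "\<mu> \<in> Arr E" "Dom E \<mu> = R \<otimes> R" "Cod E \<mu> = R" "\<eta> \<in> Arr E" "Dom E \<eta> = Unit E" "Cod E \<eta> = R"
  using mult_hom unit_hom by (auto simp: hom_iff)

declare carrier_obj [simp]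

lemma inverse_lunit_arr [simp]:
  assumes "X \<in> Obj E"
  shows "inverse_arrow (Lunit E X) \<in> Arr E" "Dom E (inverse_arrow (Lunit E X)) = X"
    "Cod E (inverse_arrow (Lunit E X)) = Unit E \<otimes> X"
  using inverse_arrow[OF lunit_iso[OF assms]] assms by simp_all

lemma inverse_assoc_arr [simp]:
  assumes "X \<in> Obj E" "Y \<in> Obj E" "Z \<in> Obj E"
  shows "inverse_arrow (Assoc E X Y Z) \<in> Arr E"
    "Dom E (inverse_arrow (Assoc E X Y Z)) = X \<otimes> (Y \<otimes> Z)"
    "Cod E (inverse_arrow (Assoc E X Y Z)) = (X \<otimes> Y) \<otimes> Z"
  using inverse_arrow[OF assoc_iso[OF assms]] assms by simp_all

lemma free_unit_arr [simp]:
  assumes "X \<in> Obj E"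
  shows "free_unit X \<in> Arr E" "Dom E (free_unit X) = X" "Cod E (free_unit X) = R \<otimes> X"
  using assms by (simp_all add: free_unit_def)

lemma free_mult_arr [simp]:
  assumes "X \<in> Obj E"
  shows "free_mult X \<in> Arr E" "Dom E (free_mult X) = R \<otimes> (R \<otimes> X)" "Cod E (free_mult X) = R \<otimes> X"
  using assms by (simp_all add: free_mult_def)

lemma free_unit_lunit:
  assumes "X \<in> Obj E"
  shows "free_unit X \<cdot> Lunit E X = \<eta> \<otimes>\<^sub>a Ident E X"
  using assms inverse_arrow[OF lunit_iso[OF assms]] by (simp add: free_unit_def assoc)

lemma free_mult_assoc:
  assumes "X \<in> Obj E"
  shows "free_mult X \<cdot> Assoc E R R X = \<mu> \<otimes>\<^sub>a Ident E X"
  using assms inverse_arrow[OF assoc_iso[of R R X]] by (simp add: free_mult_def assoc)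

lemma free_unit_natural:
  assumes f: "f \<in> Arr E"
  shows "free_unit (Cod E f) \<cdot> f = (Ident E R \<otimes>\<^sub>a f) \<cdot> free_unit (Dom E f)"
proof (rule iso_cancel_right[OF lunit_iso[of "Dom E f"]])
  have "(free_unit (Cod E f) \<cdot> f) \<cdot> Lunit E (Dom E f)
      = free_unit (Cod E f) \<cdot> Lunit E (Cod E f) \<cdot> (Ident E (Unit E) \<otimes>\<^sub>a f)"
    using f by (simp add: assoc lunit_nat)
  also have "\<dots> = (free_unit (Cod E f) \<cdot> Lunit E (Cod E f)) \<cdot> (Ident E (Unit E) \<otimes>\<^sub>a f)"
    using f by (simp add: assoc)
  also have "\<dots> = (Ident E R \<otimes>\<^sub>a f) \<cdot> (\<eta> \<otimes>\<^sub>a Ident E (Dom E f))"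
    using f by (simp add: free_unit_lunit interchange)
  also have "\<dots> = ((Ident E R \<otimes>\<^sub>a f) \<cdot> free_unit (Dom E f)) \<cdot> Lunit E (Dom E f)"
    using f by (simp add: free_unit_lunit assoc)
  finally show "(free_unit (Cod E f) \<cdot> f) \<cdot> Lunit E (Dom E f)
    = ((Ident E R \<otimes>\<^sub>a f) \<cdot> free_unit (Dom E f)) \<cdot> Lunit E (Dom E f)" .
qed (use f in simp_all)

text \<open>
  The two unit laws of the free module \<open>R \<otimes> X\<close>. They come from the unit laws of the monoid tensored
  with \<open>X\<close>; moving the unitors past the associator is Kelly's lemma for the left unit and the
  triangle axiom for the right unit.
\<close>

lemma free_mult_left_unit:
  assumes X: "X \<in> Obj E"
  shows "free_mult X \<cdot> free_unit (R \<otimes> X) = Ident E (R \<otimes> X)"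
proof (rule iso_cancel_right)
  let ?p = "Lunit E (R \<otimes> X) \<cdot> Assoc E (Unit E) R X"
  show "iso E ?p"
    using X by (intro iso_comp lunit_iso assoc_iso) simp_all
  have "(free_mult X \<cdot> free_unit (R \<otimes> X)) \<cdot> ?p
      = free_mult X \<cdot> (free_unit (R \<otimes> X) \<cdot> Lunit E (R \<otimes> X)) \<cdot> Assoc E (Unit E) R X"
    using X by (simp add: assoc)
  also have "\<dots> = free_mult X \<cdot> (\<eta> \<otimes>\<^sub>a (Ident E R \<otimes>\<^sub>a Ident E X)) \<cdot> Assoc E (Unit E) R X"
    using X by (simp add: free_unit_lunit)
  also have "\<dots> = (free_mult X \<cdot> Assoc E R R X) \<cdot> ((\<eta> \<otimes>\<^sub>a Ident E R) \<otimes>\<^sub>a Ident E X)"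
    using X assoc_nat[of \<eta> "Ident E R" "Ident E X"] by (simp add: assoc)
  also have "\<dots> = (\<mu> \<cdot> (\<eta> \<otimes>\<^sub>a Ident E R)) \<otimes>\<^sub>a Ident E X"
    using X by (simp add: free_mult_assoc interchange)
  also have "\<dots> = Ident E (R \<otimes> X) \<cdot> ?p"
    using X by (simp add: mult_left_unit lunit_tensor)
  finally show "(free_mult X \<cdot> free_unit (R \<otimes> X)) \<cdot> ?p = Ident E (R \<otimes> X) \<cdot> ?p" .
qed (use X in simp_all)

lemma free_mult_right_unit:
  assumes X: "X \<in> Obj E"
  shows "free_mult X \<cdot> (Ident E R \<otimes>\<^sub>a free_unit X) = Ident E (R \<otimes> X)"
proof (rule iso_cancel_right)
  let ?p = "(Ident E R \<otimes>\<^sub>a Lunit E X) \<cdot> Assoc E R (Unit E) X"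
  show "iso E ?p"
    using X by (intro iso_comp iso_tensor lunit_iso assoc_iso iso_ident) simp_all
  have "(free_mult X \<cdot> (Ident E R \<otimes>\<^sub>a free_unit X)) \<cdot> ?p
      = free_mult X \<cdot> ((Ident E R \<otimes>\<^sub>a free_unit X) \<cdot> (Ident E R \<otimes>\<^sub>a Lunit E X)) \<cdot> Assoc E R (Unit E) X"
    using X by (simp add: assoc)
  also have "\<dots> = free_mult X \<cdot> (Ident E R \<otimes>\<^sub>a (\<eta> \<otimes>\<^sub>a Ident E X)) \<cdot> Assoc E R (Unit E) X"
    using X by (simp add: free_unit_lunit interchange)
  also have "\<dots> = (free_mult X \<cdot> Assoc E R R X) \<cdot> ((Ident E R \<otimes>\<^sub>a \<eta>) \<otimes>\<^sub>a Ident E X)"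
    using X assoc_nat[of "Ident E R" \<eta> "Ident E X"] by (simp add: assoc)
  also have "\<dots> = (\<mu> \<cdot> (Ident E R \<otimes>\<^sub>a \<eta>)) \<otimes>\<^sub>a Ident E X"
    using X by (simp add: free_mult_assoc interchange)
  also have "\<dots> = Ident E (R \<otimes> X) \<cdot> ?p"
    using X by (simp add: mult_right_unit triangle)
  finally show "(free_mult X \<cdot> (Ident E R \<otimes>\<^sub>a free_unit X)) \<cdot> ?p = Ident E (R \<otimes> X) \<cdot> ?p" .
qed (use X in simp_all)

text \<open>
  The module axioms with all unitors and associators absorbed into the unit and the multiplication of
  the monad \<open>R \<otimes> -\<close>: they become the axioms of an algebra over that monad.
\<close>

lemma is_module_iff:
  "is_module E R \<mu> \<eta> (X, a) \<longleftrightarrow> X \<in> Obj E \<and> a \<in> hom E (R \<otimes> X) X \<and>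
     a \<cdot> free_mult X = a \<cdot> (Ident E R \<otimes>\<^sub>a a) \<and> a \<cdot> free_unit X = Ident E X"
proof -
  have 1: "a \<cdot> (\<mu> \<otimes>\<^sub>a Ident E X) = a \<cdot> (Ident E R \<otimes>\<^sub>a a) \<cdot> Assoc E R R X \<longleftrightarrow>
      a \<cdot> free_mult X = a \<cdot> (Ident E R \<otimes>\<^sub>a a)" (is "?l = ?r \<longleftrightarrow> ?l' = ?r'")
    if "X \<in> Obj E" "a \<in> hom E (R \<otimes> X) X"
  proof -
    have l: "?l = ?l' \<cdot> Assoc E R R X" and r: "?r = ?r' \<cdot> Assoc E R R X"
      using that by (auto simp: hom_iff assoc free_mult_assoc)
    show ?thesis
      unfolding l r using that iso_cancel_right[OF assoc_iso[of R R X], of ?l' ?r']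
      by (auto simp: hom_iff)
  qed
  have 2: "a \<cdot> (\<eta> \<otimes>\<^sub>a Ident E X) = Lunit E X \<longleftrightarrow> a \<cdot> free_unit X = Ident E X"
    if "X \<in> Obj E" "a \<in> hom E (R \<otimes> X) X"
  proof -
    have l: "a \<cdot> (\<eta> \<otimes>\<^sub>a Ident E X) = (a \<cdot> free_unit X) \<cdot> Lunit E X"
      using that by (auto simp: hom_iff assoc free_unit_lunit)
    show ?thesis
      unfolding l using that iso_cancel_right[OF lunit_iso[of X], of "a \<cdot> free_unit X" "Ident E X"]
      by (auto simp: hom_iff)
  qed
  show ?thesis
    using 1 2 by (auto simp: is_module_def)
qed

end

context solid_monoid_in
begin

lemma iso_free_mult: "X \<in> Obj E \<Longrightarrow> iso E (free_mult X)"
  unfolding free_mult_def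
  by (intro iso_comp iso_tensor iso_inverse_arrow mult_iso iso_ident assoc_iso) simp_all

lemma iso_free_unit_tensor: "X \<in> Obj E \<Longrightarrow> iso E (free_unit (R \<otimes> X))"
  by (rule iso_if_comp_ident[OF iso_free_mult[of X]]) (simp_all add: free_mult_left_unit)

text \<open>Both sides are sections of the same isomorphism, the free multiplication.\<close>

lemma free_unit_well_pointed:
  "X \<in> Obj E \<Longrightarrow> Ident E R \<otimes>\<^sub>a free_unit X = free_unit (R \<otimes> X)"
  by (rule iso_cancel_left[OF iso_free_mult[of X]])
    (simp_all add: free_mult_left_unit free_mult_right_unit)

text \<open>
  Naturality of the unit at \<open>r\<close> gives \<open>u\<^sub>X r = (R \<otimes> r) u\<close>, where the second \<open>u\<close> is taken at
  \<open>R \<otimes> X\<close>. Well-pointedness replaces it by \<open>R \<otimes> u\<^sub>X\<close>, so \<open>u\<^sub>X r = R \<otimes> (r u\<^sub>X)\<close> is the identity.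
\<close>

lemma split_free_unit_iso:
  assumes X: "X \<in> Obj E" and r: "r \<in> hom E (R \<otimes> X) X" and split: "r \<cdot> free_unit X = Ident E X"
  shows "iso E (free_unit X)"
proof (rule isoI[where g = r])
  have "free_unit X \<cdot> r = (Ident E R \<otimes>\<^sub>a r) \<cdot> (Ident E R \<otimes>\<^sub>a free_unit X)"
    using free_unit_natural[of r] r X by (auto simp: hom_iff free_unit_well_pointed)
  also have "\<dots> = Ident E (R \<otimes> X)"
    using r X split by (auto simp: hom_iff interchange)
  finally show "free_unit X \<cdot> r = Ident E (Cod E (free_unit X))"
    using X by simp
qed (use assms in \<open>auto simp: hom_iff\<close>)

lemma stable_object_transfer:
  assumes X: "X \<in> stable_objects" and i: "iso E i" "Dom E i = X" "Cod E i = Y"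
  shows "Y \<in> stable_objects"
proof -
  have "iso E (free_unit Y)"
  proof (rule iso_conjugate[where f = "free_unit X" and p = i and q = "Ident E R \<otimes>\<^sub>a i"])
    show "iso E (Ident E R \<otimes>\<^sub>a i)"
      by (intro iso_tensor iso_ident i) simp
    show "free_unit Y \<cdot> i = (Ident E R \<otimes>\<^sub>a i) \<cdot> free_unit X"
      using free_unit_natural[of i] iso_arr[OF i(1)] i by simp
  qed (use assms iso_arr[OF i(1)] in \<open>auto simp: stable_objects_def\<close>)
  then show ?thesis
    using i iso_arr[OF i(1)] by (auto simp: stable_objects_def)
qed

lemma tensor_stable: "X \<in> Obj E \<Longrightarrow> R \<otimes> X \<in> stable_objects"
  by (simp add: stable_objects_def iso_free_unit_tensor)

section \<open>Modules over a solid monoid\<close>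

lemma module_iff_stable:
  "is_module E R \<mu> \<eta> (X, a) \<longleftrightarrow> X \<in> stable_objects \<and> a = inverse_arrow (free_unit X)"
proof
  assume m: "is_module E R \<mu> \<eta> (X, a)"
  then have u: "iso E (free_unit X)"
    by (auto simp: is_module_iff intro: split_free_unit_iso)
  moreover have "a = inverse_arrow (free_unit X)"
    using m by (intro left_inverse_iso[OF u]) (auto simp: is_module_iff hom_iff)
  ultimately show "X \<in> stable_objects \<and> a = inverse_arrow (free_unit X)"
    using m by (auto simp: is_module_iff stable_objects_def)
next
  assume a: "X \<in> stable_objects \<and> a = inverse_arrow (free_unit X)"
  then have X: "X \<in> Obj E" and u: "iso E (free_unit X)"
    by (auto simp: stable_objects_def)
  have aX: "a \<in> hom E (R \<otimes> X) X" "a \<cdot> free_unit X = Ident E X"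
    using a X inverse_arrow[OF u] by (auto simp: hom_iff)
  (* After precomposition with the isomorphism R \<otimes> u both sides reduce to a. *)
  have "a \<cdot> free_mult X = a \<cdot> (Ident E R \<otimes>\<^sub>a a)"
  proof (rule iso_cancel_right)
    show "iso E (Ident E R \<otimes>\<^sub>a free_unit X)"
      by (intro iso_tensor iso_ident u) simp
    show "(a \<cdot> free_mult X) \<cdot> (Ident E R \<otimes>\<^sub>a free_unit X) =
        (a \<cdot> (Ident E R \<otimes>\<^sub>a a)) \<cdot> (Ident E R \<otimes>\<^sub>a free_unit X)"
      using aX X by (auto simp: hom_iff assoc interchange free_mult_right_unit)
  qed (use aX X in \<open>auto simp: hom_iff\<close>)
  then show "is_module E R \<mu> \<eta> (X, a)"
    using aX X by (simp add: is_module_iff)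
qed

lemma module_hom_stable:
  assumes X: "X \<in> stable_objects" and Y: "Y \<in> stable_objects"
  shows "module_hom E R (X, inverse_arrow (free_unit X)) (Y, inverse_arrow (free_unit Y)) = hom E X Y"
proof -
  have "f \<cdot> inverse_arrow (free_unit X) = inverse_arrow (free_unit Y) \<cdot> (Ident E R \<otimes>\<^sub>a f)"
    if f: "f \<in> hom E X Y" for f
  proof -
    have u: "X \<in> Obj E" "Y \<in> Obj E" "iso E (free_unit X)" "iso E (free_unit Y)"
      using X Y by (auto simp: stable_objects_def)
    note i = inverse_arrow[OF u(3)] inverse_arrow[OF u(4)]
    have fa: "f \<in> Arr E" "Dom E f = X" "Cod E f = Y"
      using f by (auto simp: hom_iff)
    show ?thesis
    proof (rule iso_cancel_right[OF u(3)])
      have "(inverse_arrow (free_unit Y) \<cdot> (Ident E R \<otimes>\<^sub>a f)) \<cdot> free_unit X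
          = inverse_arrow (free_unit Y) \<cdot> free_unit Y \<cdot> f"
        using free_unit_natural[OF fa(1)] fa u i by (simp add: assoc)
      also have "\<dots> = (f \<cdot> inverse_arrow (free_unit X)) \<cdot> free_unit X"
        using inverse_arrow_cancel(1)[OF u(4) fa(1)] fa u i by (simp add: assoc)
      finally show "(f \<cdot> inverse_arrow (free_unit X)) \<cdot> free_unit X
        = (inverse_arrow (free_unit Y) \<cdot> (Ident E R \<otimes>\<^sub>a f)) \<cdot> free_unit X" ..
    qed (use fa u i in simp_all)
  qed
  then show ?thesis
    by (auto simp: module_hom_def)
qed

end

section \<open>Local objects\<close>

locale closed_solid_monoid =
  closed_symmetric_monoidal_category E + solid_monoid_in E R \<mu> \<eta>
  for E :: "('o, 'a, 'm) csm_cat_scheme" (structure) and R \<mu> \<eta>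
begin

text \<open>
  Needed because the internal hom tests an equivalence with a parameter object \<open>A\<close>. Associativity
  and symmetry identify \<open>R \<otimes> (A \<otimes> f)\<close> with \<open>(R \<otimes> f) \<otimes> A\<close>.
\<close>

lemma R_equivalence_tensor:
  assumes f: "f \<in> R_equivalences E R" and A: "A \<in> Obj E"
  shows "Ident E A \<otimes>\<^sub>a f \<in> R_equivalences E R"
proof -
  have fa: "f \<in> Arr E" and i: "iso E (Ident E R \<otimes>\<^sub>a f)"
    using f by (auto simp: R_equivalences_def)
  have "iso E (Ident E R \<otimes>\<^sub>a (f \<otimes>\<^sub>a Ident E A))"
    by (rule iso_conjugate[where f = "(Ident E R \<otimes>\<^sub>a f) \<otimes>\<^sub>a Ident E A"
          and p = "Assoc E R (Dom E f) A" and q = "Assoc E R (Cod E f) A"])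
      (use fa A assoc_nat[of "Ident E R" f "Ident E A"] in
        \<open>simp_all add: i iso_tensor iso_ident assoc_iso\<close>)
  then have "iso E (Ident E R \<otimes>\<^sub>a (Ident E A \<otimes>\<^sub>a f))"
    by (rule iso_conjugate[where p = "Ident E R \<otimes>\<^sub>a Braid E (Dom E f) A"
          and q = "Ident E R \<otimes>\<^sub>a Braid E (Cod E f) A"])
      (use fa A braid_nat[of f "Ident E A"] in
        \<open>simp_all add: iso_tensor iso_ident braid_iso interchange\<close>)
  then show ?thesis
    using fa A by (simp add: R_equivalences_def)
qed

text \<open>
  The extension of \<open>h : A \<rightarrow> Z\<close> along \<open>g\<close> is forced: apply \<open>R \<otimes> -\<close>, invert \<open>R \<otimes> g\<close> there, and return
  to \<open>Z\<close> along the inverse of its unit, \<open>B \<rightarrow> R \<otimes> B \<rightarrow> R \<otimes> A \<rightarrow> R \<otimes> Z \<rightarrow> Z\<close>.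
\<close>

lemma bij_pre_comp_R_equivalence:
  assumes g: "g \<in> R_equivalences E R" "g \<in> hom E A B" and Z: "Z \<in> stable_objects"
  shows "bij_betw (\<lambda>h. h \<cdot> g) (hom E B Z) (hom E A Z)"
proof -
  let ?T = "\<lambda>f. Ident E R \<otimes>\<^sub>a f"
  let ?v = "inverse_arrow (free_unit Z)" and ?w = "inverse_arrow (?T g)"
  have ga: "g \<in> Arr E" "Dom E g = A" "Cod E g = B" and Zo: "Z \<in> Obj E"
    and AB: "A \<in> Obj E" "B \<in> Obj E"
    and u: "iso E (free_unit Z)" and t: "iso E (?T g)"
    using g Z hom_obj[OF g(2)] by (auto simp: hom_iff R_equivalences_def stable_objects_def)
  have arr [simp]: "?v \<in> Arr E" "Dom E ?v = R \<otimes> Z" "Cod E ?v = Z"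
    "?w \<in> Arr E" "Dom E ?w = R \<otimes> B" "Cod E ?w = R \<otimes> A"
    using inverse_arrow[OF u] inverse_arrow[OF t] ga AB Zo by simp_all
  have retract: "?v \<cdot> (?T h \<cdot> free_unit (Dom E h)) = h" if "h \<in> Arr E" "Cod E h = Z" for h
    using free_unit_natural[of h] inverse_arrow_cancel(1)[OF u, of h] that Zo by simp
  show ?thesis
  proof (rule bij_betw_byWitness[where f' = "\<lambda>h. ?v \<cdot> (?T h \<cdot> (?w \<cdot> free_unit B))"])
    show "\<forall>h\<in>hom E B Z. ?v \<cdot> (?T (h \<cdot> g) \<cdot> (?w \<cdot> free_unit B)) = h"
    proof
      fix h assume "h \<in> hom E B Z"
      then have h: "h \<in> Arr E" "Dom E h = B" "Cod E h = Z" by (auto simp: hom_iff)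
      have "?T (h \<cdot> g) = ?T h \<cdot> ?T g"
        using h ga by (simp add: interchange)
      then have "?T (h \<cdot> g) \<cdot> (?w \<cdot> free_unit B) = ?T h \<cdot> (?T g \<cdot> (?w \<cdot> free_unit B))"
        using h ga AB by (simp add: assoc)
      also have "?T g \<cdot> (?w \<cdot> free_unit B) = free_unit B"
        using inverse_arrow_cancel(2)[OF t, of "free_unit B"] ga AB by simp
      finally show "?v \<cdot> (?T (h \<cdot> g) \<cdot> (?w \<cdot> free_unit B)) = h"
        using retract[of h] h by simp
    qed
    show "\<forall>h\<in>hom E A Z. (?v \<cdot> (?T h \<cdot> (?w \<cdot> free_unit B))) \<cdot> g = h"
    proof
      fix h assume "h \<in> hom E A Z"
      then have h: "h \<in> Arr E" "Dom E h = A" "Cod E h = Z" by (auto simp: hom_iff)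
      have "(?v \<cdot> (?T h \<cdot> (?w \<cdot> free_unit B))) \<cdot> g = ?v \<cdot> (?T h \<cdot> (?w \<cdot> (free_unit B \<cdot> g)))"
        using h ga AB by (simp add: assoc)
      also have "free_unit B \<cdot> g = ?T g \<cdot> free_unit A"
        using free_unit_natural[of g] ga by simp
      also have "?w \<cdot> (?T g \<cdot> free_unit A) = free_unit A"
        using inverse_arrow_cancel(1)[OF t, of "free_unit A"] ga AB by simp
      finally show "(?v \<cdot> (?T h \<cdot> (?w \<cdot> free_unit B))) \<cdot> g = h"
        using retract[of h] h by simp
    qed
  qed (use ga AB Zo in \<open>auto simp: hom_iff\<close>)
qed

lemma free_unit_R_equivalence: "X \<in> Obj E \<Longrightarrow> free_unit X \<in> R_equivalences E R"
  by (simp add: R_equivalences_def free_unit_well_pointed iso_free_unit_tensor)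

lemma R_local_iff_stable: "R_local_objects E R = stable_objects"
proof (intro equalityI subsetI)
  fix Z assume Z: "Z \<in> stable_objects"
  then have Zo: "Z \<in> Obj E" by (simp add: stable_objects_def)
  have "iso E (ihom_pre E f Z)" if f: "f \<in> R_equivalences E R" for f
  proof -
    have f': "f \<in> hom E (Dom E f) (Cod E f)"
      using f by (simp add: R_equivalences_def hom_iff)
    show ?thesis
      unfolding iso_ihom_pre_iff[OF f' Zo]
      using R_equivalence_tensor[OF f] Z f'
      by (intro ballI bij_pre_comp_R_equivalence) (auto simp: hom_iff)
  qed
  then show "Z \<in> R_local_objects E R"
    using Zo by (simp add: R_local_objects_def)
next
  fix Z assume "Z \<in> R_local_objects E R"
  then have Z: "Z \<in> Obj E" and i: "iso E (ihom_pre E (free_unit Z) Z)"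
    using free_unit_R_equivalence by (auto simp: R_local_objects_def)
  (* Locality is used with parameter object I: there it extends the identity of Z along u. *)
  let ?I = "Unit E" and ?u = "free_unit Z"
  have u: "?u \<in> hom E Z (R \<otimes> Z)"
    using Z by (simp add: hom_iff)
  have "bij_betw (\<lambda>h. h \<cdot> (Ident E ?I \<otimes>\<^sub>a ?u)) (hom E (?I \<otimes> (R \<otimes> Z)) Z) (hom E (?I \<otimes> Z) Z)"
    using i unfolding iso_ihom_pre_iff[OF u Z] by simp
  moreover have "Lunit E Z \<in> hom E (?I \<otimes> Z) Z"
    using Z by (rule lunit_hom)
  ultimately obtain k where k: "k \<in> hom E (?I \<otimes> (R \<otimes> Z)) Z"
    "k \<cdot> (Ident E ?I \<otimes>\<^sub>a ?u) = Lunit E Z"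
    unfolding bij_betw_def by (metis (no_types, lifting) imageE)
  let ?r = "k \<cdot> inverse_arrow (Lunit E (R \<otimes> Z))"
  have "?r \<cdot> ?u = Ident E Z"
  proof (rule iso_cancel_right[OF lunit_iso[OF Z]])
    have "(?r \<cdot> ?u) \<cdot> Lunit E Z = ?r \<cdot> (Lunit E (R \<otimes> Z) \<cdot> (Ident E ?I \<otimes>\<^sub>a ?u))"
      using k Z lunit_nat[of ?u] by (auto simp: hom_iff assoc)
    also have "\<dots> = k \<cdot> (Ident E ?I \<otimes>\<^sub>a ?u)"
      using k Z inverse_arrow_cancel(1)[OF lunit_iso[of "R \<otimes> Z"]] by (auto simp: hom_iff assoc)
    finally show "(?r \<cdot> ?u) \<cdot> Lunit E Z = Ident E Z \<cdot> Lunit E Z"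
      using k Z by simp
  qed (use k Z in \<open>auto simp: hom_iff\<close>)
  then have "iso E ?u"
    using k Z by (intro split_free_unit_iso[where r = ?r]) (auto simp: hom_iff)
  then show "Z \<in> stable_objects"
    using Z by (simp add: stable_objects_def)
qed

section \<open>Colocal objects\<close>

text \<open>
  The unit \<open>X \<rightarrow> X \<otimes> R\<close> for the tensor product in the order in which the internal hom is adjoint to
  it. Defining it through the braiding, instead of the right unitor, makes its properties immediate
  from those of the left version, without comparing the braiding with the unitors.
\<close>

definition right_free_unit :: "'o \<Rightarrow> 'a" where
  "right_free_unit X = Braid E R X \<cdot> free_unit X"

lemma right_free_unit_arr [simp]:
  assumes "X \<in> Obj E"
  shows "right_free_unit X \<in> Arr E" "Dom E (right_free_unit X) = X"
    "Cod E (right_free_unit X) = X \<otimes> R"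
  using assms by (simp_all add: right_free_unit_def)

lemma right_free_unit_natural:
  assumes f: "f \<in> Arr E"
  shows "right_free_unit (Cod E f) \<cdot> f = (f \<otimes>\<^sub>a Ident E R) \<cdot> right_free_unit (Dom E f)"
proof -
  have "right_free_unit (Cod E f) \<cdot> f = Braid E R (Cod E f) \<cdot> (Ident E R \<otimes>\<^sub>a f) \<cdot> free_unit (Dom E f)"
    using f by (simp add: right_free_unit_def assoc free_unit_natural)
  also have "\<dots> = (Braid E R (Cod E f) \<cdot> (Ident E R \<otimes>\<^sub>a f)) \<cdot> free_unit (Dom E f)"
    using f by (simp add: assoc)
  also have "\<dots> = (f \<otimes>\<^sub>a Ident E R) \<cdot> right_free_unit (Dom E f)"
    using f braid_nat[of "Ident E R" f] by (simp add: right_free_unit_def assoc)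
  finally show ?thesis .
qed

lemma iso_right_free_unit: "X \<in> stable_objects \<Longrightarrow> iso E (right_free_unit X)"
  unfolding right_free_unit_def stable_objects_def by (auto intro!: iso_comp braid_iso)

lemma right_tensor_stable: "X \<in> Obj E \<Longrightarrow> X \<otimes> R \<in> stable_objects"
  by (rule stable_object_transfer[OF tensor_stable braid_iso[of R X]]) simp_all

definition eval_unit :: "'o \<Rightarrow> 'a" where
  "eval_unit Z = Eval E R Z \<cdot> right_free_unit (Ihom E R Z)"

lemma eval_unit_arr:
  assumes "Z \<in> Obj E"
  shows "eval_unit Z \<in> hom E (Ihom E R Z) Z"
  using assms by (simp add: eval_unit_def hom_iff)

text \<open>
  Evaluation at the unit is uncurrying followed by restriction along the right unit. On objects of the
  form \<open>A \<otimes> R\<close> the latter is an isomorphism, which makes \<open>eval_unit\<close> an \<open>R\<close>-colocal equivalence.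
\<close>

lemma eval_unit_comp:
  assumes Z: "Z \<in> Obj E" and h: "h \<in> hom E B (Ihom E R Z)"
  shows "eval_unit Z \<cdot> h = (Eval E R Z \<cdot> (h \<otimes>\<^sub>a Ident E R)) \<cdot> right_free_unit B"
  using assms right_free_unit_natural[of h] hom_obj[OF h]
  by (auto simp: eval_unit_def hom_iff assoc)

lemma eval_unit_R_colocal_equivalence:
  assumes Z: "Z \<in> Obj E"
  shows "eval_unit Z \<in> R_colocal_equivalences E R"
proof -
  have "bij_betw (\<lambda>h. eval_unit Z \<cdot> h) (hom E (A \<otimes> R) (Ihom E R Z)) (hom E (A \<otimes> R) Z)"
    if A: "A \<in> Obj E" for A
  proof -
    have B: "A \<otimes> R \<in> Obj E" using A by simp
    have "bij_betw (\<lambda>k. k \<cdot> right_free_unit (A \<otimes> R)) (hom E ((A \<otimes> R) \<otimes> R) Z) (hom E (A \<otimes> R) Z)"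
      using A by (intro bij_pre_comp_iso iso_right_free_unit right_tensor_stable) simp_all
    from bij_betw_trans[OF bij_uncurry[OF B carrier_obj Z] this]
    show ?thesis
      by (rule bij_betw_cong[THEN iffD1, rotated]) (simp add: eval_unit_comp[OF Z])
  qed
  then have "iso E (ihom_post E R (eval_unit Z))"
    unfolding iso_ihom_post_iff[OF eval_unit_arr[OF Z] carrier_obj] by blast
  then show ?thesis
    using eval_unit_arr[OF Z] by (simp add: R_colocal_equivalences_def hom_iff)
qed

lemma R_colocal_iff_stable: "R_colocal_objects E R = stable_objects"
proof (intro equalityI subsetI)
  fix Z assume Z: "Z \<in> stable_objects"
  then have Zo: "Z \<in> Obj E" and u: "iso E (free_unit Z)"
    by (simp_all add: stable_objects_def)
  have "iso E (ihom_post E Z g)" if "g \<in> R_colocal_equivalences E R" for g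
  proof -
    have g: "g \<in> hom E (Dom E g) (Cod E g)" and "iso E (ihom_post E R g)"
      using that by (simp_all add: R_colocal_equivalences_def hom_iff)
    then have R: "bij_betw (\<lambda>h. g \<cdot> h) (hom E (A \<otimes> R) (Dom E g)) (hom E (A \<otimes> R) (Cod E g))"
      if "A \<in> Obj E" for A
      using that iso_ihom_post_iff[OF g carrier_obj] by blast
    have "bij_betw (\<lambda>h. g \<cdot> h) (hom E (A \<otimes> Z) (Dom E g)) (hom E (A \<otimes> Z) (Cod E g))"
      if A: "A \<in> Obj E" for A
    proof (rule bij_post_comp_transfer[OF _ _ _ g R[of "Z \<otimes> A"]])
      (* A \<otimes> Z \<rightarrow> Z \<otimes> A \<rightarrow> (R \<otimes> Z) \<otimes> A \<rightarrow> R \<otimes> (Z \<otimes> A) \<rightarrow> (Z \<otimes> A) \<otimes> R *)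
      let ?i = "Braid E R (Z \<otimes> A) \<cdot> Assoc E R Z A \<cdot> (free_unit Z \<otimes>\<^sub>a Ident E A) \<cdot> Braid E A Z"
      show "iso E ?i"
        using A Zo u by (intro iso_comp braid_iso assoc_iso iso_tensor iso_ident) simp_all
      show "Dom E ?i = A \<otimes> Z" "Cod E ?i = (Z \<otimes> A) \<otimes> R" "Z \<otimes> A \<in> Obj E"
        using A Zo by simp_all
    qed
    then show ?thesis
      unfolding iso_ihom_post_iff[OF g Zo] by blast
  qed
  then show "Z \<in> R_colocal_objects E R"
    using Zo by (simp add: R_colocal_objects_def)
next
  fix Z assume "Z \<in> R_colocal_objects E R"
  then have Z: "Z \<in> Obj E" and i: "iso E (ihom_post E Z (eval_unit Z))"
    using eval_unit_R_colocal_equivalence by (auto simp: R_colocal_objects_def)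
  let ?I = "Unit E" and ?H = "Ihom E R Z" and ?l = "inverse_arrow (Lunit E Z)"
  have "bij_betw (\<lambda>h. eval_unit Z \<cdot> h) (hom E (?I \<otimes> Z) ?H) (hom E (?I \<otimes> Z) Z)"
    using i unfolding iso_ihom_post_iff[OF eval_unit_arr[OF Z] Z] by simp
  then have "bij_betw (\<lambda>h. eval_unit Z \<cdot> h) (hom E Z ?H) (hom E Z Z)"
    by (rule bij_post_comp_transfer[where i = ?l, rotated -1])
      (use Z eval_unit_arr[OF Z] iso_inverse_arrow[OF lunit_iso[OF Z]] in simp_all)
  then obtain s where s: "s \<in> hom E Z ?H" "eval_unit Z \<cdot> s = Ident E Z"
    unfolding bij_betw_def using ident_hom[OF Z] by (metis (no_types, lifting) imageE)
  (* The left inverse of u is the transpose Z \<otimes> R \<rightarrow> Z of s, with the factors swapped. *)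
  let ?r = "(Eval E R Z \<cdot> (s \<otimes>\<^sub>a Ident E R)) \<cdot> Braid E R Z"
  have "?r \<cdot> free_unit Z = eval_unit Z \<cdot> s"
    unfolding eval_unit_comp[OF Z s(1)] using s(1) Z
    by (auto simp: right_free_unit_def hom_iff assoc)
  then have "iso E (free_unit Z)"
    using s Z by (intro split_free_unit_iso[where r = ?r]) (auto simp: hom_iff)
  then show "Z \<in> stable_objects"
    using Z by (simp add: stable_objects_def)
qed

end

section \<open>The equivalences\<close>

lemma hom_full_subcategory:
  "hom (full_subcategory C P) X Y = (if X \<in> P \<and> Y \<in> P then hom C X Y else {})"
  by (auto simp: hom_def full_subcategory_def)

lemma category_full_subcategory:
  assumes "category C"
  shows "category (full_subcategory C P)"
proof -
  interpret category C by fact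
  show ?thesis
  proof
    fix W X Y Z f g h
    assume "f \<in> hom (full_subcategory C P) W X" "g \<in> hom (full_subcategory C P) X Y"
      "h \<in> hom (full_subcategory C P) Y Z"
    then have "(h \<cdot>\<^bsub>C\<^esub> g) \<cdot>\<^bsub>C\<^esub> f = h \<cdot>\<^bsub>C\<^esub> (g \<cdot>\<^bsub>C\<^esub> f)"
      by (intro comp_assoc[of f W X g Y h Z]) (simp_all add: hom_full_subcategory split: if_splits)
    then show "Comp (full_subcategory C P) (Comp (full_subcategory C P) h g) f =
      Comp (full_subcategory C P) h (Comp (full_subcategory C P) g f)"
      by (simp add: full_subcategory_def)
  qed (auto simp: hom_def full_subcategory_def)
qed

lemma hom_module_category:
  "hom (module_category E R \<mu> \<eta>) M N =
    {(M, f, N) | f. is_module E R \<mu> \<eta> M \<and> is_module E R \<mu> \<eta> N \<and> f \<in> module_hom E R M N}"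
  by (auto simp: hom_def module_category_def)

text \<open>
  An isomorphism of categories is an equivalence in either direction, the natural isomorphisms
  being identities.
\<close>

lemma equivalent_if_inverse_functors:
  assumes C: "category C" and D: "category D"
    and F: "is_functor C D F" and G: "is_functor D C G"
    and GFo: "\<And>X. X \<in> Obj C \<Longrightarrow> Fobj G (Fobj F X) = X"
    and GFa: "\<And>f. f \<in> Arr C \<Longrightarrow> Farr G (Farr F f) = f"
    and FGo: "\<And>X. X \<in> Obj D \<Longrightarrow> Fobj F (Fobj G X) = X"
    and FGa: "\<And>f. f \<in> Arr D \<Longrightarrow> Farr F (Farr G f) = f"
  shows "equivalent_categories C D"
proof -
  interpret C: category C by fact
  interpret D: category D by fact
  have "nat_iso C C id_fun (comp_fun G F) (Ident C)"
    using GFo GFa C.iso_ident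
    by (auto simp: nat_iso_def nat_trans_def id_fun_def comp_fun_def hom_iff)
  moreover have "nat_iso D D (comp_fun F G) id_fun (Ident D)"
    using FGo FGa D.iso_ident
    by (auto simp: nat_iso_def nat_trans_def id_fun_def comp_fun_def hom_iff)
  ultimately show ?thesis
    unfolding equivalent_categories_def using assms by blast
qed

context monoid_in
begin

lemma module_hom_ident:
  assumes "is_module E R \<mu> \<eta> M"
  shows "Ident E (fst M) \<in> module_hom E R M M"
  using assms by (cases M) (auto simp: is_module_def module_hom_def hom_iff)

lemma module_hom_comp:
  assumes M: "is_module E R \<mu> \<eta> M" "is_module E R \<mu> \<eta> N" "is_module E R \<mu> \<eta> P"
    and f: "f \<in> module_hom E R M N" and g: "g \<in> module_hom E R N P"
  shows "g \<cdot> f \<in> module_hom E R M P"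
proof -
  obtain X a Y b Z d where [simp]: "M = (X, a)" "N = (Y, b)" "P = (Z, d)"
    by (cases M; cases N; cases P)
  have abd: "a \<in> hom E (R \<otimes> X) X" "b \<in> hom E (R \<otimes> Y) Y" "d \<in> hom E (R \<otimes> Z) Z"
    using M by (simp_all add: is_module_def)
  have fg: "f \<in> hom E X Y" "g \<in> hom E Y Z"
    and lin: "f \<cdot> a = b \<cdot> (Ident E R \<otimes>\<^sub>a f)" "g \<cdot> b = d \<cdot> (Ident E R \<otimes>\<^sub>a g)"
    using f g by (simp_all add: module_hom_def)
  have "(g \<cdot> f) \<cdot> a = (g \<cdot> b) \<cdot> (Ident E R \<otimes>\<^sub>a f)"
    using fg abd lin(1) by (auto simp: hom_iff assoc)
  also have "\<dots> = d \<cdot> ((Ident E R \<otimes>\<^sub>a g) \<cdot> (Ident E R \<otimes>\<^sub>a f))"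
    unfolding lin(2) using fg abd by (auto simp: hom_iff assoc)
  also have "\<dots> = d \<cdot> (Ident E R \<otimes>\<^sub>a (g \<cdot> f))"
    using fg by (auto simp: hom_iff interchange)
  finally show ?thesis
    using comp_hom[OF fg] by (simp add: module_hom_def)
qed

lemma category_module_category: "category (module_category E R \<mu> \<eta>)"
proof
  fix M N P Q and f g h :: "('o \<times> 'a) \<times> 'a \<times> ('o \<times> 'a)"
  let ?M = "module_category E R \<mu> \<eta>"
  have und: "\<exists>k. f = (M, k, N) \<and> k \<in> hom E (fst M) (fst N)" if "f \<in> hom ?M M N" for f M N
    using that by (auto simp: hom_module_category module_hom_def split: prod.splits)
  show "f \<in> hom ?M M N \<Longrightarrow> Comp ?M f (Ident ?M M) = f"
    "f \<in> hom ?M M N \<Longrightarrow> Comp ?M (Ident ?M N) f = f"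
    by (drule und; auto simp: module_category_def hom_iff)+
  show "Comp ?M g f \<in> hom ?M M P" if "f \<in> hom ?M M N" "g \<in> hom ?M N P"
    using that module_hom_comp[of M N P] by (auto simp: hom_module_category) (simp add: module_category_def)
  show "Comp ?M (Comp ?M h g) f = Comp ?M h (Comp ?M g f)"
    if fgh: "f \<in> hom ?M M N" "g \<in> hom ?M N P" "h \<in> hom ?M P Q"
    using und[OF fgh(1)] und[OF fgh(2)] und[OF fgh(3)]
    by (auto simp: module_category_def intro: comp_assoc)
qed (auto simp: hom_def module_category_def module_hom_ident)

end

context solid_monoid_in
begin

text \<open>
  The functors are mutually inverse on the nose: one equips a stable object with its only module
  structure, the other forgets it.
\<close>

lemma stable_modules_equivalent:
  "equivalent_categories (full_subcategory E stable_objects) (module_category E R \<mu> \<eta>)"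
  "equivalent_categories (module_category E R \<mu> \<eta>) (full_subcategory E stable_objects)"
proof -
  let ?S = "full_subcategory E stable_objects" and ?M = "module_category E R \<mu> \<eta>"
  define m where "m X = (X, inverse_arrow (free_unit X))" for X
  define F where "F = \<lparr>Fobj = m, Farr = (\<lambda>f. (m (Dom E f), f, m (Cod E f)))\<rparr>"
  define G :: "('a \<times> 'b, ('a \<times> 'b) \<times> 'b \<times> ('a \<times> 'b), 'a, 'b) fun_data"
    where "G = \<lparr>Fobj = fst, Farr = (\<lambda>(M, f, N). f)\<rparr>"
  have objS: "Obj ?S = stable_objects"
    by (auto simp: full_subcategory_def stable_objects_def)
  have objM: "Obj ?M = m ` stable_objects"
    using module_iff_stable by (auto simp: module_category_def m_def image_iff)
  have homS: "hom ?S X Y = (if X \<in> stable_objects \<and> Y \<in> stable_objects then hom E X Y else {})"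
    for X Y
    by (rule hom_full_subcategory)
  have homM: "hom ?M M N = {(m X, f, m Y) | X f Y. M = m X \<and> N = m Y \<and> f \<in> hom ?S X Y}" for M N
    unfolding hom_module_category homS m_def
    by (cases M; cases N) (auto simp: module_iff_stable module_hom_stable)
  have F: "is_functor ?S ?M F"
    unfolding is_functor_def objS objM homS homM
    by (auto simp: F_def hom_iff module_category_def full_subcategory_def stable_objects_def m_def
        split: if_splits)
  have G: "is_functor ?M ?S G"
    unfolding is_functor_def objS objM homM
    by (auto simp: G_def module_category_def full_subcategory_def m_def homS)
  have GF: "Fobj G (Fobj F X) = X" "Farr G (Farr F f) = f" for X f
    by (simp_all add: F_def G_def m_def)
  have FGo: "Fobj F (Fobj G M) = M" if "M \<in> Obj ?M" for M
    using that unfolding objM by (auto simp: F_def G_def m_def)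
  have FGa: "Farr F (Farr G f) = f" if "f \<in> Arr ?M" for f
  proof -
    have "f \<in> hom ?M (Dom ?M f) (Cod ?M f)"
      using that by (simp add: hom_iff)
    then show ?thesis
      unfolding homM homS by (auto simp: F_def G_def hom_iff split: if_splits)
  qed
  note S = category_full_subcategory[OF category_axioms]
  show "equivalent_categories ?S ?M"
    by (rule equivalent_if_inverse_functors[OF S category_module_category F G GF FGo FGa])
  show "equivalent_categories ?M ?S"
    by (rule equivalent_if_inverse_functors[OF category_module_category S G F FGo FGa GF])
qed

end

theorem theorem3p6:
  fixes E :: "('o, 'a, 'm) csm_cat_scheme"
    and R :: 'o and \<mu> \<eta> :: 'a
    and L\<^sub>R C\<^sub>R :: "('o, 'a, 'o, 'a) fun_data"
    and l c :: "'o \<Rightarrow> 'a"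
  assumes "closed_symmetric_monoidal_category E"
    and "cocomplete TYPE('s) E"
    and "solid_monoid_in E R \<mu> \<eta>"
    and "is_L_R E R L\<^sub>R l"
    and "is_C_R E R C\<^sub>R c"
  shows "equivalent_categories (full_subcategory E (image_objects E L\<^sub>R)) (module_category E R \<mu> \<eta>) \<and>
    equivalent_categories (module_category E R \<mu> \<eta>) (full_subcategory E (image_objects E C\<^sub>R))"
proof -
  interpret closed_solid_monoid E R \<mu> \<eta>
    by (rule closed_solid_monoid.intro) fact+
  have "image_objects E L\<^sub>R = stable_objects" "image_objects E C\<^sub>R = stable_objects"
    using assms(4,5) by (simp_all add: is_L_R_def is_C_R_def R_local_iff_stable R_colocal_iff_stable)
  then show ?thesis
    using stable_modules_equivalent by simp
qed

end
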